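(* Let $\Omega,\Omega^*$ be compact metric spaces and let $\mathcal T$ be one of the transport costs of type (I), (II) or (III) described in the context, and let $E(\nu)=H_{f,m}(\nu)+\int_{\Omega^*}V\,d\nu$ as in the context. For $\mu_1,\mu_2\in\mathcal M_+(\Omega)$, let $\nu_i=\mathcal S(\mu_i)$. Then $\mu_1\leq\mu_2$ implies $\nu_1\leq\nu_2$.
   Context: $\mathcal M_+(A)$ is the set of finite positive Borel measures on $A$, ordered by $\mu\leq\mu'$ iff $\mu(B)\leq\mu'(B)$ for every Borel $B$. Let $c\in C(\Omega\times\Omega^* )$ and let $\Pi(\mu,\nu)$ be the set of positive measures on $\Omega\times\Omega^*$ with marginals $\mu,\nu$. The costs are: (I) $\mathcal T_c(\mu,\nu)=\inf_{\pi\in\Pi(\mu,\nu)}\int c\,d\pi$ ($+\infty$ if masses differ); (II) for $\varepsilon>0$ and non-null $\alpha\in\mathcal M_+(\Omega),\beta\in\mathcal M_+(\Omega^* )$, $\mathcal T_{c,\varepsilon}(\mu,\nu)=\inf_{\pi\in\Pi(\mu,\nu)}\int c\,d\pi+\varepsilon\mathrm{KL}(\pi\mid\alpha\otimes\beta)$, with $\mathrm{KL}(m_1\mid m_2)=\int(s\log s-s)|_{s=dm_1/dm_2}\,dm_2$ if $m_1\ll m_2$ and $+\infty$ otherwise; (III) for two finite-valued entropy functions $h_0,h_1\colon[0,\infty)\to[0,\infty)$, $\mathcal{UT}_{h,c}(\mu,\nu)=\inf_{\pi\in\mathcal M_+(\Omega\times\Omega^* )}H_{h_0,\mu}(\pi_0)+H_{h_1,\nu}(\pi_1)+\int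 c\,d\pi$ ($\pi_0,\pi_1$ marginals of $\pi$). An entropy function is a proper convex lower semicontinuous $h\colon[0,\infty)\to[0,\infty]$ with $h(s)/s\to\infty$; for $m\in\mathcal M_+$, $H_{h,m}(\rho)=\int h(d\rho/dm)\,dm$ if $\rho\geq0$, $\rho\ll m$, and $+\infty$ otherwise. In $E$: $f\colon[0,\infty)\to[0,\infty)$ is a finite, strictly convex entropy function, $m\in\mathcal M_+(\Omega^* )$ is non-null, and $V\in C(\Omega^* )$. For each $\mu\in\mathcal M_+(\Omega)$ the problem $\min_{\nu\in\mathcal M_+(\Omega^* )}\mathcal T(\mu,\nu)+E(\nu)$ admits a unique minimizer, denoted $\mathcal S(\mu)$. *)

theory Defs
  imports "HOL-Analysis.Analysis"
begin

definition fin_meas :: "'a::topological_space set \<Rightarrow> 'a measure set" where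
  "fin_meas A = {M. sets M = sets (restrict_space borel A) \<and> emeasure M A < \<infinity>}"

(* Borel sigma-algebra on Omega x Omega_star (for compact metric spaces, which are
   separable, this coincides with the Borel sets of the product space). *)
definition prod_borel :: "'a::topological_space set \<Rightarrow> 'b::topological_space set \<Rightarrow> ('a \<times> 'b) measure" where
  "prod_borel A B = restrict_space borel A \<Otimes>\<^sub>M restrict_space borel B"

definition fin_meas_prod :: "'a::topological_space set \<Rightarrow> 'b::topological_space set \<Rightarrow> ('a \<times> 'b) measure set" where
  "fin_meas_prod A B = {M. sets M = sets (prod_borel A B) \<and> emeasure M (A \<times> B) < \<infinity>}"

definition meas_le :: "'a measure \<Rightarrow> 'a measure \<Rightarrow> bool" where
  "meas_le M N \<longleftrightarrow> (\<forall>B \<in> sets M. emeasure M B \<le> emeasure N B)"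

definition marg0 :: "'a::topological_space set \<Rightarrow> ('a \<times> 'b) measure \<Rightarrow> 'a measure" where
  "marg0 A P = distr P (restrict_space borel A) fst"

definition marg1 :: "'b::topological_space set \<Rightarrow> ('a \<times> 'b) measure \<Rightarrow> 'b measure" where
  "marg1 B P = distr P (restrict_space borel B) snd"

definition couplings :: "'a::topological_space set \<Rightarrow> 'b::topological_space set \<Rightarrow> 'a measure \<Rightarrow> 'b measure \<Rightarrow> ('a \<times> 'b) measure set" where
  "couplings A B mu nu = {P \<in> fin_meas_prod A B. marg0 A P = mu \<and> marg1 B P = nu}"

(* Extended integral of a function that is integrable from below:
   integral of the positive part minus integral of the negative part. *)
definition ext_int :: "'a measure \<Rightarrow> ('a \<Rightarrow> real) \<Rightarrow> ereal" where
  "ext_int M g = enn2ereal (\<integral>\<^sup>+x. ennreal (g x) \<partial>M) - enn2ereal (\<integral>\<^sup>+x. ennreal (- g x) \<partial>M)"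

(* KL(m1 | m2) = int (s log s - s) with s = d m1 / d m2, if m1 << m2; +inf otherwise.
   (Isabelle's ln 0 = 0, giving the convention 0 log 0 = 0.) *)
definition KL :: "'a measure \<Rightarrow> 'a measure \<Rightarrow> ereal" where
  "KL m1 m2 = (if sets m1 = sets m2 \<and> absolutely_continuous m2 m1
     then ext_int m2 (\<lambda>x. let s = enn2real (RN_deriv m2 m1 x) in s * ln s - s)
     else \<infinity>)"

definition strict_convex_on :: "real set \<Rightarrow> (real \<Rightarrow> real) \<Rightarrow> bool" where
  "strict_convex_on S h \<longleftrightarrow> (\<forall>x\<in>S. \<forall>y\<in>S. x \<noteq> y \<longrightarrow>
     (\<forall>t::real. 0 < t \<and> t < 1 \<longrightarrow> h ((1 - t) * x + t * y) < (1 - t) * h x + t * h y))"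

definition entropy_fun :: "(real \<Rightarrow> real) \<Rightarrow> bool" where
  "entropy_fun h \<longleftrightarrow> (\<forall>s\<ge>0. h s \<ge> 0) \<and> convex_on {0..} h \<and>
     (\<forall>s\<ge>0. \<forall>e>0. eventually (\<lambda>t. h t > h s - e) (at s within {0..})) \<and>
     filterlim (\<lambda>s. h s / s) at_top at_top"

definition Hent :: "(real \<Rightarrow> real) \<Rightarrow> 'a measure \<Rightarrow> 'a measure \<Rightarrow> ereal" where
  "Hent h m rho = (if sets rho = sets m \<and> absolutely_continuous m rho
     then enn2ereal (\<integral>\<^sup>+x. ennreal (h (enn2real (RN_deriv m rho x))) \<partial>m)
     else \<infinity>)"

definition OT_cost :: "'a::topological_space set \<Rightarrow> 'b::topological_space set \<Rightarrow> ('a \<times> 'b \<Rightarrow> real)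
    \<Rightarrow> 'a measure \<Rightarrow> 'b measure \<Rightarrow> ereal" where
  "OT_cost A B c mu nu = (INF P \<in> couplings A B mu nu. ereal (integral\<^sup>L P c))"

definition EOT_cost :: "'a::topological_space set \<Rightarrow> 'b::topological_space set \<Rightarrow> ('a \<times> 'b \<Rightarrow> real)
    \<Rightarrow> real \<Rightarrow> 'a measure \<Rightarrow> 'b measure \<Rightarrow> 'a measure \<Rightarrow> 'b measure \<Rightarrow> ereal" where
  "EOT_cost A B c eps alpha beta mu nu =
     (INF P \<in> couplings A B mu nu. ereal (integral\<^sup>L P c) + ereal eps * KL P (alpha \<Otimes>\<^sub>M beta))"

definition UOT_cost :: "'a::topological_space set \<Rightarrow> 'b::topological_space set \<Rightarrow> ('a \<times> 'b \<Rightarrow> real)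
    \<Rightarrow> (real \<Rightarrow> real) \<Rightarrow> (real \<Rightarrow> real) \<Rightarrow> 'a measure \<Rightarrow> 'b measure \<Rightarrow> ereal" where
  "UOT_cost A B c h0 h1 mu nu =
     (INF P \<in> fin_meas_prod A B. Hent h0 mu (marg0 A P) + Hent h1 nu (marg1 B P) + ereal (integral\<^sup>L P c))"

definition Efun :: "(real \<Rightarrow> real) \<Rightarrow> 'b measure \<Rightarrow> ('b \<Rightarrow> real) \<Rightarrow> 'b measure \<Rightarrow> ereal" where
  "Efun f m V nu = Hent f m nu + ereal (integral\<^sup>L nu V)"

definition is_minimizer :: "'b::topological_space set \<Rightarrow> ('a measure \<Rightarrow> 'b measure \<Rightarrow> ereal)
    \<Rightarrow> ('b measure \<Rightarrow> ereal) \<Rightarrow> 'a measure \<Rightarrow> 'b measure \<Rightarrow> bool" where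
  "is_minimizer B T E mu nu \<longleftrightarrow> nu \<in> fin_meas B \<and>
     (\<forall>nu' \<in> fin_meas B. T mu nu + E nu \<le> T mu nu' + E nu')"

end

theory Submission
  imports Defs
begin

text \<open>
  The argument is purely primal. Let \<open>d\<^sub>1, d\<^sub>2\<close> be the densities of \<open>\<nu>\<^sub>1, \<nu>\<^sub>2\<close> with respect
  to \<open>m\<close> and suppose that \<open>{d\<^sub>1 > d\<^sub>2}\<close> has positive measure. Take nearly optimal plans
  \<open>\<pi>\<^sub>1, \<pi>\<^sub>2\<close> and let \<open>P\<close> and \<open>N\<close> be half of the positive and negative parts of
  \<open>\<pi>\<^sub>2 - \<pi>\<^sub>1\<close>. Transfer \<open>h(x) P - g(y) N\<close> from the second plan to the first, where the weights
  \<open>g, h\<close> with values in \<open>[0,1]\<close> form a fixed point of a monotone iteration: mass removed by \<open>g N\<close>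
  is compensated by \<open>h P\<close> in the first marginal as far as \<open>P\<close> permits, and whatever \<open>h P\<close> brings
  to a target point beyond its deficit is passed on by \<open>g N\<close>. As \<open>\<mu>\<^sub>1 \<le> \<mu>\<^sub>2\<close>, fixed first
  marginals are preserved, while the second marginals are averaged where that of \<open>\<pi>\<^sub>1\<close> exceeds
  that of \<open>\<pi>\<^sub>2\<close>, and elsewhere the first one grows without overshooting the second. Joint convexity
  and homogeneity of the integrands show that the total transport cost does not increase, whereas
  strict convexity of \<open>f\<close> decreases the total of \<open>E\<close> by an amount that depends only on
  \<open>d\<^sub>1, d\<^sub>2\<close> and not on the accuracy of the plans. Neither optimal plans nor duality are needed.
\<close>

section \<open>Densities of marginals\<close>

text \<open>Averaging the two plans outright would give the strict gain, but it would average the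
  first marginals too, which costs with prescribed marginals forbid. Using the whole positive and
  negative parts instead of halves would merely swap the two second marginals where the first is
  larger, leaving the total of \<open>E\<close> unchanged there; with halves the same bookkeeping
  produces the midpoint, and strict convexity pays. The weights are forced by a chain reaction.
  Removing mass at a target disturbs the first marginal at some sources; the repair there deposits
  mass at other targets, whose overflow must be removed again, and so on without bound. A monotone
  limit performs all rounds at once. For prescribed first marginals the repair never falls short:
  the marginal density of P minus that of N is half the difference of the two source densities,
  which is nonnegative when \<mu>1 \<le> \<mu>2.\<close>

locale marginal_density = sigma_finite_measure M for M :: "'x measure" +
  fixes L :: "'c measure" and t :: "'c \<Rightarrow> 'x"
  assumes t_meas [measurable]: "t \<in> measurable L M"
    and ac: "absolutely_continuous M (distr L M t)"
begin

text \<open>Values in \<open>ennreal\<close> keep sums, suprema and truncated differences of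
  densities free of side conditions. \<open>D\<close> is adjoint to composition with
  \<open>t\<close> (\<open>nn_integral_D\<close>), and its algebra below rests on this
  duality.\<close>

definition D :: "('c \<Rightarrow> ennreal) \<Rightarrow> 'x \<Rightarrow> ennreal" where
  "D p = RN_deriv M (distr (density L p) M t)"

lemma measurable_D [measurable]: "D p \<in> borel_measurable M"
  by (simp add: D_def)

lemma density_D:
  assumes p [measurable]: "p \<in> borel_measurable L"
  shows "density M (D p) = distr (density L p) M t"
proof -
  have "absolutely_continuous M (distr (density L p) M t)"
    unfolding absolutely_continuous_def
  proof
    fix B assume B: "B \<in> null_sets M"
    then have "B \<in> null_sets (distr L M t)"
      using ac by (auto simp: absolutely_continuous_def)
    then have "t -` B \<inter> space L \<in> null_sets L"
      by (simp add: null_sets_distr_iff)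
    then have "t -` B \<inter> space L \<in> null_sets (density L p)"
      using absolutely_continuousI_density[OF p] by (auto simp: absolutely_continuous_def)
    then show "B \<in> null_sets (distr (density L p) M t)"
      using B by (subst null_sets_distr_iff) auto
  qed
  then show ?thesis
    unfolding D_def by (intro density_RN_deriv) auto
qed

lemma nn_integral_D:
  assumes [measurable]: "p \<in> borel_measurable L" "k \<in> borel_measurable M"
  shows "(\<integral>\<^sup>+x. k x * D p x \<partial>M) = (\<integral>\<^sup>+z. k (t z) * p z \<partial>L)"
proof -
  have "(\<integral>\<^sup>+x. k x * D p x \<partial>M) = (\<integral>\<^sup>+x. k x \<partial>density M (D p))"
    by (subst nn_integral_density) (auto simp: mult.commute)
  also have "\<dots> = (\<integral>\<^sup>+z. k (t z) \<partial>density L p)"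
    by (subst density_D, simp, subst nn_integral_distr) auto
  also have "\<dots> = (\<integral>\<^sup>+z. k (t z) * p z \<partial>L)"
    by (subst nn_integral_density) (auto simp: mult.commute)
  finally show ?thesis .
qed

text \<open>Indicators already determine a density over a sigma-finite measure; admitting every test
  function \<open>k\<close> turns each rule for \<open>D\<close> into an identity of integrals over
  \<open>L\<close>.\<close>

lemma D_eqI:
  assumes [measurable]: "p \<in> borel_measurable L" "r \<in> borel_measurable M"
    and eq: "\<And>k. k \<in> borel_measurable M \<Longrightarrow> (\<integral>\<^sup>+x. k x * r x \<partial>M) = (\<integral>\<^sup>+z. k (t z) * p z \<partial>L)"
  shows "AE x in M. D p x = r x"
proof (rule density_unique)
  show "density M (D p) = density M r"
  proof (rule measure_eqI)
    fix B assume "B \<in> sets (density M (D p))"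
    then have [measurable]: "B \<in> sets M" by simp
    have "(\<integral>\<^sup>+x. indicator B x * D p x \<partial>M) = (\<integral>\<^sup>+x. indicator B x * r x \<partial>M)"
      by (subst nn_integral_D, simp, simp, subst eq) auto
    then show "emeasure (density M (D p)) B = emeasure (density M r) B"
      by (simp add: emeasure_density mult.commute)
  qed simp
qed auto

lemma D_cong_AE:
  assumes [measurable]: "p \<in> borel_measurable L" "q \<in> borel_measurable L"
    and "AE z in L. p z = q z"
  shows "AE x in M. D p x = D q x"
proof (rule D_eqI)
  fix k :: "'x \<Rightarrow> ennreal" assume [measurable]: "k \<in> borel_measurable M"
  show "(\<integral>\<^sup>+x. k x * D q x \<partial>M) = (\<integral>\<^sup>+z. k (t z) * p z \<partial>L)"
    using assms(3) by (subst nn_integral_D, simp, simp, intro nn_integral_cong_AE) auto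
qed auto

lemma D_add:
  assumes [measurable]: "p \<in> borel_measurable L" "q \<in> borel_measurable L"
  shows "AE x in M. D (\<lambda>z. p z + q z) x = D p x + D q x"
proof (rule D_eqI)
  fix k :: "'x \<Rightarrow> ennreal" assume [measurable]: "k \<in> borel_measurable M"
  show "(\<integral>\<^sup>+x. k x * (D p x + D q x) \<partial>M) = (\<integral>\<^sup>+z. k (t z) * (p z + q z) \<partial>L)"
    by (simp add: distrib_left nn_integral_add nn_integral_D)
qed auto

lemma D_mult:
  assumes [measurable]: "p \<in> borel_measurable L" "h \<in> borel_measurable M"
  shows "AE x in M. D (\<lambda>z. h (t z) * p z) x = h x * D p x"
proof (rule D_eqI)
  fix k :: "'x \<Rightarrow> ennreal" assume [measurable]: "k \<in> borel_measurable M"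
  show "(\<integral>\<^sup>+x. k x * (h x * D p x) \<partial>M) = (\<integral>\<^sup>+z. k (t z) * (h (t z) * p z) \<partial>L)"
    using nn_integral_D[of p "\<lambda>x. k x * h x"] by (simp add: mult.assoc)
qed auto

lemma D_mono:
  assumes [measurable]: "p \<in> borel_measurable L" "q \<in> borel_measurable L"
    and le: "AE z in L. p z \<le> q z"
  shows "AE x in M. D p x \<le> D q x"
proof -
  have "AE x in M. D q x = D (\<lambda>z. p z + (q z - p z)) x"
    using le by (intro D_cong_AE) (auto simp: add_diff_inverse_ennreal elim!: eventually_mono)
  then show ?thesis
    using D_add[OF assms(1) borel_measurable_minus_ennreal[OF assms(2,1)]] by eventually_elim auto
qed

lemma D_SUP:
  fixes p :: "nat \<Rightarrow> 'c \<Rightarrow> ennreal"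
  assumes [measurable]: "\<And>n. p n \<in> borel_measurable L"
    and mono: "\<And>n. AE z in L. p n z \<le> p (Suc n) z"
  shows "AE x in M. D (\<lambda>z. SUP n. p n z) x = (SUP n. D (p n) x)"
proof (rule D_eqI)
  fix k :: "'x \<Rightarrow> ennreal" assume [measurable]: "k \<in> borel_measurable M"
  have "(\<integral>\<^sup>+x. k x * (SUP n. D (p n) x) \<partial>M) = (\<integral>\<^sup>+x. (SUP n. k x * D (p n) x) \<partial>M)"
    by (simp add: SUP_mult_left_ennreal)
  also have "\<dots> = (SUP n. \<integral>\<^sup>+x. k x * D (p n) x \<partial>M)"
  proof (rule nn_integral_monotone_convergence_SUP_AE)
    show "AE x in M. k x * D (p n) x \<le> k x * D (p (Suc n)) x" for n
      using D_mono[OF _ _ mono[of n]] by (auto elim!: eventually_mono intro: mult_left_mono)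
  qed auto
  also have "\<dots> = (SUP n. \<integral>\<^sup>+z. k (t z) * p n z \<partial>L)"
    by (simp add: nn_integral_D)
  also have "\<dots> = (\<integral>\<^sup>+z. (SUP n. k (t z) * p n z) \<partial>L)"
  proof (rule nn_integral_monotone_convergence_SUP_AE[symmetric])
    show "AE z in L. k (t z) * p n z \<le> k (t z) * p (Suc n) z" for n
      using mono[of n] by (auto elim!: eventually_mono intro: mult_left_mono)
  qed auto
  finally show "(\<integral>\<^sup>+x. k x * (SUP n. D (p n) x) \<partial>M) = (\<integral>\<^sup>+z. k (t z) * (SUP n. p n z) \<partial>L)"
    by (simp add: SUP_mult_left_ennreal)
qed auto

lemma D_finite:
  assumes [measurable]: "p \<in> borel_measurable L" and "(\<integral>\<^sup>+z. p z \<partial>L) \<noteq> \<infinity>"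
  shows "AE x in M. D p x \<noteq> \<infinity>"
proof (rule nn_integral_PInf_AE)
  show "(\<integral>\<^sup>+x. D p x \<partial>M) \<noteq> \<infinity>"
    using nn_integral_D[of p "\<lambda>_. 1"] assms by simp
qed simp

text \<open>The weights are compared only up to null sets of \<open>M\<close>. Absolute continuity
  of the image of \<open>L\<close> carries these comparisons to \<open>L\<close>, where the weights
  multiply \<open>P\<close> and \<open>N\<close>.\<close>

lemma AE_pullback:
  assumes "AE x in M. Q x"
  shows "AE z in L. Q (t z)"
  using absolutely_continuous_AE[OF _ ac assms] AE_distrD[OF t_meas] by simp

end

section \<open>Transfer weights as a monotone fixed point\<close>

lemma min_one_divide_mult:
  fixes a p :: ennreal
  assumes "p \<noteq> \<infinity>"
  shows "min 1 (a / p) * p = min p a"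
proof (cases "p = 0")
  case False
  then have "a / p * p = a"
    using assms by (simp add: ennreal_divide_times ennreal_times_divide[symmetric] less_top)
  moreover have "min 1 u * p = min p (u * p)" for u
    by (cases "u \<le> 1") (auto simp: min_def intro: antisym mult_right_mono
        dest: mult_right_mono[of u 1 p] mult_right_mono[of 1 u p])
  ultimately show ?thesis by simp
qed simp

lemma SUP_from_Suc:
  fixes f :: "nat \<Rightarrow> 'a::complete_lattice"
  assumes "f 0 = bot"
  shows "(SUP n. f (Suc n)) = (SUP n. f n)"
proof (rule antisym)
  show "(SUP n. f n) \<le> (SUP n. f (Suc n))"
  proof (rule SUP_least)
    show "f n \<le> (SUP n. f (Suc n))" for n
      using assms by (cases n) (auto intro: SUP_upper)
  qed
qed (auto intro: SUP_least SUP_upper)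

locale two_marginals = X: marginal_density M0 L t0 + Y: marginal_density M1 L t1
  for M0 :: "'x measure" and M1 :: "'y measure" and L :: "'c measure" and t0 t1
begin

text \<open>At each source \<open>h P\<close> returns what \<open>g N\<close> removes, as far as
  \<open>P\<close> reaches; at each target \<open>g N\<close> removes exactly the excess of
  \<open>h P\<close> over the (possibly negative) deficit P - N. A solution is the supremum of an
  iteration started at zero: positivity of \<open>D\<close> makes it increasing, and continuity of
  \<open>D\<close> along increasing sequences carries the equations to the limit.\<close>

lemma exchange_weights:
  assumes [measurable]: "P \<in> borel_measurable L" "N \<in> borel_measurable L"
    and finP: "(\<integral>\<^sup>+z. P z \<partial>L) \<noteq> \<infinity>" and finN: "(\<integral>\<^sup>+z. N z \<partial>L) \<noteq> \<infinity>"
  obtains g h where "g \<in> borel_measurable M1" "h \<in> borel_measurable M0"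
    "\<And>y. g y \<le> 1" "\<And>x. h x \<le> 1"
    "AE x in M0. h x * X.D P x = min (X.D P x) (X.D (\<lambda>z. g (t1 z) * N z) x)"
    "AE y in M1. g y * Y.D N y + Y.D P y = max (Y.D (\<lambda>z. h (t0 z) * P z) y + Y.D N y) (Y.D P y)"
proof -
  \<comment> \<open>\<open>H g\<close> is the fraction of \<open>P\<close> that compensates
    \<open>g N\<close>, and \<open>G h\<close> the fraction of \<open>N\<close> that passes on the
    overflow of \<open>h P\<close>. Subtraction in \<open>ennreal\<close> truncates at zero, so
    without overflow \<open>G h\<close> is zero. Where a denominator vanishes, only the product with
    it matters.\<close>
  define H where "H g x = min 1 (X.D (\<lambda>z. g (t1 z) * N z) x / X.D P x)" for g x
  define G where "G h y = min 1 ((Y.D (\<lambda>z. h (t0 z) * P z) y + Y.D N y - Y.D P y) / Y.D N y)" for h y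
  have [measurable]: "H g \<in> borel_measurable M0" if [measurable]: "g \<in> borel_measurable M1" for g
    unfolding H_def[abs_def] by measurable
  have [measurable]: "G h \<in> borel_measurable M1" if [measurable]: "h \<in> borel_measurable M0" for h
    unfolding G_def[abs_def] by measurable
  define k where "k = rec_nat (\<lambda>_. 0) (\<lambda>_ h. H (G h))"
  have k0: "k 0 = (\<lambda>_. 0)" and kS: "k (Suc n) = H (G (k n))" for n
    by (simp_all add: k_def)
  define gs where "gs n = G (k n)" for n
  have km [measurable]: "k n \<in> borel_measurable M0" for n
    by (induction n) (simp_all add: k0 kS)
  have gm [measurable]: "gs n \<in> borel_measurable M1" for n
    by (simp add: gs_def)
  have gs1: "gs n y \<le> 1" and k1: "k n x \<le> 1" for n x y
    by (simp_all add: gs_def G_def) (cases n; simp add: k0 kS H_def)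
  have G_mono: "AE y in M1. G h y \<le> G h' y"
    if [measurable]: "h \<in> borel_measurable M0" "h' \<in> borel_measurable M0"
      and le: "AE x in M0. h x \<le> h' x" for h h'
  proof -
    have "AE y in M1. Y.D (\<lambda>z. h (t0 z) * P z) y \<le> Y.D (\<lambda>z. h' (t0 z) * P z) y"
      using X.AE_pullback[OF le]
      by (intro Y.D_mono) (auto elim!: eventually_mono intro: mult_right_mono)
    then show ?thesis
      unfolding G_def
      by (eventually_elim) (intro min.mono order_refl divide_right_mono_ennreal ennreal_minus_mono add_mono)
  qed
  have H_mono: "AE x in M0. H g x \<le> H g' x"
    if [measurable]: "g \<in> borel_measurable M1" "g' \<in> borel_measurable M1"
      and le: "AE y in M1. g y \<le> g' y" for g g'
  proof -
    have "AE x in M0. X.D (\<lambda>z. g (t1 z) * N z) x \<le> X.D (\<lambda>z. g' (t1 z) * N z) x"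
      using Y.AE_pullback[OF le]
      by (intro X.D_mono) (auto elim!: eventually_mono intro: mult_right_mono)
    then show ?thesis
      unfolding H_def by eventually_elim (intro min.mono order_refl divide_right_mono_ennreal)
  qed
  have k_mono: "AE x in M0. k n x \<le> k (Suc n) x" for n
  proof (induction n)
    case (Suc n)
    show ?case
      unfolding kS[of "Suc n"] unfolding kS[of n]
      by (intro H_mono G_mono) (use Suc in \<open>simp_all add: kS\<close>)
  qed (simp add: k0)
  have gs_mono: "AE y in M1. gs n y \<le> gs (Suc n) y" for n
    unfolding gs_def by (intro G_mono k_mono) auto
  define h where "h x = (SUP n. k n x)" for x
  define g where "g y = (SUP n. gs n y)" for y
  have [measurable]: "h \<in> borel_measurable M0" "g \<in> borel_measurable M1"
    unfolding h_def[abs_def] g_def[abs_def] by measurable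
  \<comment> \<open>The iteration starts at the bottom, so dropping its first term leaves the
    supremum unchanged and makes every term of the form \<open>H (gs n)\<close>.\<close>
  have h_alt: "h x = (SUP n. k (Suc n) x)" for x
    unfolding h_def by (rule SUP_from_Suc[symmetric]) (simp add: k0 bot_ennreal)
  have "AE x in M0. X.D (\<lambda>z. g (t1 z) * N z) x = (SUP n. X.D (\<lambda>z. gs n (t1 z) * N z) x)"
    unfolding g_def SUP_mult_right_ennreal
  proof (rule X.D_SUP)
    show "AE z in L. gs n (t1 z) * N z \<le> gs (Suc n) (t1 z) * N z" for n
      using Y.AE_pullback[OF gs_mono] by eventually_elim (auto intro: mult_right_mono)
  qed measurable
  with X.D_finite[OF assms(1) finP]
  have gh: "AE x in M0. h x * X.D P x = min (X.D P x) (X.D (\<lambda>z. g (t1 z) * N z) x)"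
  proof eventually_elim
    case (elim x)
    have "h x * X.D P x = (SUP n. k (Suc n) x * X.D P x)"
      by (simp add: h_alt SUP_mult_right_ennreal)
    also have "\<dots> = (SUP n. inf (X.D P x) (X.D (\<lambda>z. gs n (t1 z) * N z) x))"
      using elim by (simp add: kS H_def gs_def[symmetric] min_one_divide_mult inf_min)
    also have "\<dots> = inf (X.D P x) (SUP n. X.D (\<lambda>z. gs n (t1 z) * N z) x)"
      by (rule inf_SUP[symmetric])
    finally show ?case using elim by (simp add: inf_min)
  qed
  have "AE y in M1. Y.D (\<lambda>z. h (t0 z) * P z) y = (SUP n. Y.D (\<lambda>z. k n (t0 z) * P z) y)"
    unfolding h_def SUP_mult_right_ennreal
  proof (rule Y.D_SUP)
    show "AE z in L. k n (t0 z) * P z \<le> k (Suc n) (t0 z) * P z" for n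
      using X.AE_pullback[OF k_mono] by eventually_elim (auto intro: mult_right_mono)
  qed measurable
  moreover have "AE y in M1. \<forall>n. Y.D (\<lambda>z. k n (t0 z) * P z) y \<le> Y.D P y"
    unfolding AE_all_countable
  proof (intro allI Y.D_mono AE_I2)
    show "k n (t0 z) * P z \<le> P z" for n z
      using mult_right_mono[OF k1[of n "t0 z"], of "P z"] by simp
  qed measurable
  moreover note Y.D_finite[OF assms(1) finP] Y.D_finite[OF assms(2) finN]
  ultimately have hg: "AE y in M1. g y * Y.D N y + Y.D P y
      = max (Y.D (\<lambda>z. h (t0 z) * P z) y + Y.D N y) (Y.D P y)"
  proof eventually_elim
    case (elim y)
    let ?b = "\<lambda>n. Y.D (\<lambda>z. k n (t0 z) * P z) y"
    have eq: "gs n y * Y.D N y + Y.D P y = sup (?b n + Y.D N y) (Y.D P y)" for n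
    proof -
      \<comment> \<open>Since \<open>k n\<close> is at most 1, the overflow never exceeds the
        marginal of \<open>N\<close>; hence the truncation at 1 in \<open>G\<close> is
        inactive.\<close>
      have "?b n + Y.D N y - Y.D P y \<le> Y.D N y"
        using elim(2)[rule_format, of n] elim(3,4) by (simp add: ennreal_minus_le_iff add_right_mono)
      then have "gs n y * Y.D N y = ?b n + Y.D N y - Y.D P y"
        using elim by (simp add: gs_def G_def min_one_divide_mult min.absorb2)
      moreover have "u - p + p = sup u p" if "p \<noteq> \<infinity>" for u p :: ennreal
        using that
        by (cases "p \<le> u") (auto simp: sup_max max_def diff_add_cancel_ennreal diff_eq_0_ennreal less_top)
      ultimately show ?thesis using elim by simp
    qed
    have "g y * Y.D N y + Y.D P y = (SUP n. gs n y * Y.D N y + Y.D P y)"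
      by (simp add: g_def SUP_mult_right_ennreal ennreal_SUP_add_left)
    also have "\<dots> = sup (SUP n. ?b n + Y.D N y) (Y.D P y)"
      by (simp add: eq) (subst Complete_Lattices.SUP_sup_distrib[symmetric], simp)
    also have "(SUP n. ?b n + Y.D N y) = Y.D (\<lambda>z. h (t0 z) * P z) y + Y.D N y"
      by (simp add: elim ennreal_SUP_add_left)
    finally show ?case by (simp add: sup_max)
  qed
  show ?thesis
    by (rule that[OF _ _ _ _ gh hg]) (auto simp: g_def h_def intro!: SUP_least gs1 k1)
qed

end

section \<open>Exchange of mass between two plans\<close>

text \<open>Here \<open>a\<close> is removed and \<open>min P a\<close> is returned. If r1 \<le> r2,
  the balance gives N \<le> P, so a \<le> P, all is returned and the density stays at
  \<open>r1\<close>. Otherwise the loss is at most N - P = (r1 - r2)/2. The clamp does not alter the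
  value; it lets the formula serve as a definition whose bounds hold at every point.\<close>

lemma exchanged_density_source:
  fixes D a P N :: ennreal
  assumes "D + a = ennreal r1 + min P a" "P + P + ennreal r1 = N + N + ennreal r2"
    "a \<le> N" "P \<noteq> \<infinity>" "N \<noteq> \<infinity>" "0 \<le> r1" "0 \<le> r2"
  shows "D = ennreal (if r1 \<le> r2 then r1 else min r1 (max r2 (enn2real D)))"
proof -
  have "a \<noteq> \<infinity>" using assms(3,5) by (auto simp: top_unique)
  moreover have "D + a \<noteq> \<infinity>"
    unfolding assms(1) using assms(4) \<open>a \<noteq> \<infinity>\<close> by (simp add: min_def)
  ultimately show ?thesis
    using assms
    by (cases D; cases a; cases P; cases N)
      (auto simp: ennreal_plus[symmetric] min_def max_def simp del: ennreal_plus split: if_splits)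
qed

text \<open>Here \<open>b\<close> is received and \<open>w\<close>, the positive part of b + N - P,
  is passed on. If q2 < q1, then P < N, nothing is truncated, and q1 + P - N is the midpoint.
  Otherwise the net gain is the minimum of \<open>b\<close> and P - N, hence at most (q2 -
  q1)/2.\<close>

lemma exchanged_density_target:
  fixes D b w P N :: ennreal
  assumes "D + w = ennreal q1 + b" "P + P + ennreal q1 = N + N + ennreal q2"
    "w + P = max (b + N) P" "b \<le> P" "P \<noteq> \<infinity>" "N \<noteq> \<infinity>" "0 \<le> q1" "0 \<le> q2"
  shows "D = ennreal (if q2 < q1 then (q1 + q2) / 2 else min q2 (max q1 (enn2real D)))"
proof -
  have "b \<noteq> \<infinity>" using assms(4,5) by (auto simp: top_unique)
  moreover have "w + P \<noteq> \<infinity>"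
    unfolding assms(3) using assms(5,6) \<open>b \<noteq> \<infinity>\<close> by (simp add: max_def)
  moreover have "D + w \<noteq> \<infinity>"
    unfolding assms(1) using \<open>b \<noteq> \<infinity>\<close> by simp
  ultimately show ?thesis
    using assms
    by (cases D; cases b; cases w; cases P; cases N)
      (auto simp: ennreal_plus[symmetric] min_def max_def field_simps simp del: ennreal_plus split: if_splits)
qed

section \<open>Marginals of the exchanged plans\<close>

context marginal_density
begin

lemma distr_density_iff:
  assumes "p \<in> borel_measurable L" "r \<in> borel_measurable M"
  shows "distr (density L p) M t = density M r \<longleftrightarrow> (AE x in M. D p x = r x)"
  using density_unique_iff[of "D p" r] assms by (simp add: density_D)

lemma D_add_eq:
  assumes [measurable]: "p \<in> borel_measurable L" "q \<in> borel_measurable L"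
      "p' \<in> borel_measurable L" "q' \<in> borel_measurable L"
    and "\<And>z. p z + q z = p' z + q' z"
  shows "AE x in M. D p x + D q x = D p' x + D q' x"
proof -
  have "AE x in M. D (\<lambda>z. p z + q z) x = D p x + D q x"
    by (intro D_add) auto
  moreover have "AE x in M. D (\<lambda>z. p z + q z) x = D p' x + D q' x"
    unfolding assms(5) by (intro D_add) auto
  ultimately show ?thesis by eventually_elim simp
qed

text \<open>Shaped for the balance 2 P + s1 = 2 N + s2, which describes the two halves without
  subtraction or division.\<close>

lemma D_double_add_eq:
  assumes [measurable]: "p \<in> borel_measurable L" "q \<in> borel_measurable L"
      "p' \<in> borel_measurable L" "q' \<in> borel_measurable L"
    and "\<And>z. p z + p z + q z = p' z + p' z + q' z"
  shows "AE x in M. D p x + D p x + D q x = D p' x + D p' x + D q' x"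
proof -
  have "AE x in M. D (\<lambda>z. p z + p z) x + D q x = D (\<lambda>z. p' z + p' z) x + D q' x"
    by (intro D_add_eq assms(5)) auto
  moreover have "AE x in M. D (\<lambda>z. p z + p z) x = D p x + D p x"
    "AE x in M. D (\<lambda>z. p' z + p' z) x = D p' x + D p' x"
    by (intro D_add; measurable)+
  ultimately show ?thesis by eventually_elim simp
qed

lemma distr_density_diff:
  fixes s1 s2 s :: "'c \<Rightarrow> real" and r1 r2 r :: "'x \<Rightarrow> real"
  assumes [measurable]: "s1 \<in> borel_measurable L" "s2 \<in> borel_measurable L" "s \<in> borel_measurable L"
      "r1 \<in> borel_measurable M" "r2 \<in> borel_measurable M" "r \<in> borel_measurable M"
    and s: "\<And>z. 0 \<le> s1 z" "\<And>z. 0 \<le> s2 z" "\<And>z. 0 \<le> s z" "\<And>z. s z \<le> s1 z + s2 z"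
    and r: "\<And>x. 0 \<le> r1 x" "\<And>x. 0 \<le> r2 x" "\<And>x. 0 \<le> r x" "\<And>x. r x \<le> r1 x + r2 x"
    and "distr (density L s1) M t = density M r1" "distr (density L s2) M t = density M r2"
      "distr (density L s) M t = density M r"
  shows "distr (density L (\<lambda>z. s1 z + s2 z - s z)) M t = density M (\<lambda>x. r1 x + r2 x - r x)"
proof -
  have eq: "AE x in M. D s1 x = r1 x" "AE x in M. D s2 x = r2 x" "AE x in M. D s x = r x"
    using assms by (simp_all add: distr_density_iff)
  have "(\<lambda>z. ennreal (s z) + ennreal (s1 z + s2 z - s z)) = (\<lambda>z. ennreal (s1 z) + ennreal (s2 z))"
    using s by (auto simp: fun_eq_iff ennreal_plus[symmetric] simp del: ennreal_plus)
  then have "AE x in M. D s x + D (\<lambda>z. s1 z + s2 z - s z) x = D s1 x + D s2 x"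
    using D_add[of "\<lambda>z. ennreal (s z)" "\<lambda>z. ennreal (s1 z + s2 z - s z)"]
      D_add[of "\<lambda>z. ennreal (s1 z)" "\<lambda>z. ennreal (s2 z)"] by auto
  with eq have "AE x in M. D (\<lambda>z. s1 z + s2 z - s z) x = ennreal (r1 x + r2 x - r x)"
  proof eventually_elim
    case (elim x)
    then have "ennreal (r x) + D (\<lambda>z. s1 z + s2 z - s z) x = ennreal (r1 x + r2 x)"
      using r by simp
    then show ?case
      using r[of x] by (cases "D (\<lambda>z. s1 z + s2 z - s z) x")
        (auto simp: ennreal_plus[symmetric] simp del: ennreal_plus)
  qed
  then show ?thesis by (subst distr_density_iff) auto
qed

end

context two_marginals
begin

text \<open>The second new plan is the remainder of the sum of the old ones, so sums of plans and of
  marginals are preserved. The bounds on \<open>s\<close>, \<open>r\<close>, \<open>q\<close> hold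
  everywhere, since suitable versions of the densities are chosen; later pointwise arguments about
  them then meet no exceptional sets.\<close>

lemma plan_exchange:
  fixes s1 s2 :: "'c \<Rightarrow> real" and r1 r2 :: "'x \<Rightarrow> real" and q1 q2 :: "'y \<Rightarrow> real"
  assumes [measurable]: "s1 \<in> borel_measurable L" "s2 \<in> borel_measurable L"
      "r1 \<in> borel_measurable M0" "r2 \<in> borel_measurable M0"
      "q1 \<in> borel_measurable M1" "q2 \<in> borel_measurable M1"
    and nonneg: "\<And>z. 0 \<le> s1 z" "\<And>z. 0 \<le> s2 z" "\<And>x. 0 \<le> r1 x" "\<And>x. 0 \<le> r2 x"
      "\<And>y. 0 \<le> q1 y" "\<And>y. 0 \<le> q2 y"
    and int: "integrable L s1" "integrable L s2"
    and r1: "distr (density L s1) M0 t0 = density M0 r1"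
    and r2: "distr (density L s2) M0 t0 = density M0 r2"
    and q1: "distr (density L s1) M1 t1 = density M1 q1"
    and q2: "distr (density L s2) M1 t1 = density M1 q2"
  obtains s r q :: "_ \<Rightarrow> real" where
    "s \<in> borel_measurable L" "r \<in> borel_measurable M0" "q \<in> borel_measurable M1"
    "\<And>z. min (s1 z) (s2 z) \<le> s z" "\<And>z. s z \<le> max (s1 z) (s2 z)"
    "distr (density L s) M0 t0 = density M0 r"
    "distr (density L (\<lambda>z. s1 z + s2 z - s z)) M0 t0 = density M0 (\<lambda>x. r1 x + r2 x - r x)"
    "distr (density L s) M1 t1 = density M1 q"
    "distr (density L (\<lambda>z. s1 z + s2 z - s z)) M1 t1 = density M1 (\<lambda>y. q1 y + q2 y - q y)"
    "\<And>x. r1 x \<le> r2 x \<Longrightarrow> r x = r1 x"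
    "\<And>x. r2 x \<le> r1 x \<Longrightarrow> r2 x \<le> r x \<and> r x \<le> r1 x"
    "\<And>y. q2 y < q1 y \<Longrightarrow> q y = (q1 y + q2 y) / 2"
    "\<And>y. q1 y \<le> q2 y \<Longrightarrow> q1 y \<le> q y \<and> q y \<le> q2 y"
proof -
  define P where "P z = ennreal ((s2 z - s1 z) / 2)" for z
  define N where "N z = ennreal ((s1 z - s2 z) / 2)" for z
  have [measurable]: "P \<in> borel_measurable L" "N \<in> borel_measurable L"
    unfolding P_def[abs_def] N_def[abs_def] by measurable
  have fin: "(\<integral>\<^sup>+z. P z \<partial>L) \<noteq> \<infinity>" "(\<integral>\<^sup>+z. N z \<partial>L) \<noteq> \<infinity>"
  proof -
    have "integrable L (\<lambda>z. (s2 z - s1 z) / 2)" "integrable L (\<lambda>z. (s1 z - s2 z) / 2)"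
      using int by auto
    then show "(\<integral>\<^sup>+z. P z \<partial>L) \<noteq> \<infinity>" "(\<integral>\<^sup>+z. N z \<partial>L) \<noteq> \<infinity>"
      unfolding P_def N_def by (auto simp: real_integrable_def)
  qed
  obtain g h where [measurable]: "g \<in> borel_measurable M1" "h \<in> borel_measurable M0"
    and g_le: "\<And>y. g y \<le> 1" and h_le: "\<And>x. h x \<le> 1"
    and gh: "AE x in M0. h x * X.D P x = min (X.D P x) (X.D (\<lambda>z. g (t1 z) * N z) x)"
    and hg: "AE y in M1. g y * Y.D N y + Y.D P y = max (Y.D (\<lambda>z. h (t0 z) * P z) y + Y.D N y) (Y.D P y)"
    using exchange_weights[of P N] fin by auto
  define h' where "h' x = enn2real (h x)" for x
  define g' where "g' y = enn2real (g y)" for y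
  have h': "h x = ennreal (h' x)" "0 \<le> h' x" "h' x \<le> 1" for x
    using h_le[of x] by (auto simp: h'_def ennreal_enn2real_if top_unique intro: enn2real_leI)
  have g': "g y = ennreal (g' y)" "0 \<le> g' y" "g' y \<le> 1" for y
    using g_le[of y] by (auto simp: g'_def ennreal_enn2real_if top_unique intro: enn2real_leI)
  have [measurable]: "h' \<in> borel_measurable M0" "g' \<in> borel_measurable M1"
    unfolding h'_def[abs_def] g'_def[abs_def] by measurable
  \<comment> \<open>This is s1 + h P - g N; \<open>P\<close> and \<open>N\<close> are never positive
    at the same point, so the two cases separate. Weights at most 1 and the factor one half keep
    \<open>s\<close> between \<open>s1\<close> and the midpoint.\<close>
  define s where "s z = (if s1 z \<le> s2 z then s1 z + h' (t0 z) * ((s2 z - s1 z) / 2)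
      else s1 z - g' (t1 z) * ((s1 z - s2 z) / 2))" for z
  have [measurable]: "s \<in> borel_measurable L"
    unfolding s_def[abs_def] by measurable
  have mult_bounds: "0 \<le> c * e" "c * e \<le> e" if "0 \<le> c" "c \<le> 1" "0 \<le> e" for c e :: real
    using that by (auto intro: mult_left_le_one_le)
  have s_between: "min (s1 z) (s2 z) \<le> s z" "s z \<le> max (s1 z) (s2 z)" for z
  proof -
    define u v where "u = h' (t0 z) * ((s2 z - s1 z) / 2)" and "v = g' (t1 z) * ((s1 z - s2 z) / 2)"
    have "0 \<le> u" "u \<le> (s2 z - s1 z) / 2" if "s1 z \<le> s2 z"
      using mult_bounds h'(2,3) that unfolding u_def by simp_all
    moreover have "0 \<le> v" "v \<le> (s1 z - s2 z) / 2" if "s2 z < s1 z"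
      using mult_bounds g'(2,3) that unfolding v_def by simp_all
    moreover have "s z = (if s1 z \<le> s2 z then s1 z + u else s1 z - v)"
      by (simp only: s_def u_def v_def)
    ultimately show "min (s1 z) (s2 z) \<le> s z" "s z \<le> max (s1 z) (s2 z)"
      by (cases "s1 z \<le> s2 z"; simp)+
  qed
  have s_nonneg: "0 \<le> s z" for z
    using s_between(1)[of z] nonneg(1,2)[of z] by linarith
  have s_eq: "ennreal (s z) + g (t1 z) * N z = ennreal (s1 z) + h (t0 z) * P z" for z
  proof (cases "s1 z \<le> s2 z")
    case True
    then show ?thesis
      using h'(1,2)[of "t0 z"] nonneg(1)[of z]
      by (simp add: s_def P_def N_def ennreal_neg ennreal_mult[symmetric])
  next
    case False
    then show ?thesis
      using g'(1,2)[of "t1 z"] nonneg(1)[of z] s_nonneg[of z]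
      by (simp add: s_def P_def N_def ennreal_neg ennreal_mult[symmetric] ennreal_plus[symmetric]
          del: ennreal_plus)
  qed
  have balance: "P z + P z + ennreal (s1 z) = N z + N z + ennreal (s2 z)" for z
    using nonneg(1,2)[of z]
    by (cases "s1 z \<le> s2 z")
      (simp_all add: P_def N_def ennreal_neg ennreal_plus[symmetric] del: ennreal_plus)
  have g_N: "g (t1 z) * N z \<le> N z" and h_P: "h (t0 z) * P z \<le> P z" for z
    using mult_right_mono[OF g_le[of "t1 z"], of "N z"] mult_right_mono[OF h_le[of "t0 z"], of "P z"]
    by simp_all
  define r where "r x = (if r1 x \<le> r2 x then r1 x else min (r1 x) (max (r2 x) (enn2real (X.D s x))))" for x
  define q where "q y = (if q2 y < q1 y then (q1 y + q2 y) / 2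
      else min (q2 y) (max (q1 y) (enn2real (Y.D s y))))" for y
  have [measurable]: "r \<in> borel_measurable M0" "q \<in> borel_measurable M1"
    unfolding r_def[abs_def] q_def[abs_def] by measurable
  have "AE x in M0. X.D s1 x = r1 x" "AE x in M0. X.D s2 x = r2 x"
    using r1 r2 by (simp_all add: X.distr_density_iff)
  moreover have "AE x in M0. X.D s x + X.D (\<lambda>z. g (t1 z) * N z) x = X.D s1 x + X.D (\<lambda>z. h (t0 z) * P z) x"
    by (intro X.D_add_eq s_eq) auto
  moreover have "AE x in M0. X.D P x + X.D P x + X.D s1 x = X.D N x + X.D N x + X.D s2 x"
    by (intro X.D_double_add_eq balance) auto
  moreover have "AE x in M0. X.D (\<lambda>z. g (t1 z) * N z) x \<le> X.D N x"
    by (intro X.D_mono) (auto intro: g_N)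
  moreover have "AE x in M0. X.D (\<lambda>z. h (t0 z) * P z) x = h x * X.D P x"
    by (intro X.D_mult) auto
  moreover have "AE x in M0. X.D P x \<noteq> \<infinity>" "AE x in M0. X.D N x \<noteq> \<infinity>"
    by (intro X.D_finite fin; measurable)+
  moreover note gh
  ultimately have Dr: "AE x in M0. X.D s x = ennreal (r x)"
  proof eventually_elim
    case (elim x)
    then show ?case
      unfolding r_def
      by (intro exchanged_density_source[where a = "X.D (\<lambda>z. g (t1 z) * N z) x" and P = "X.D P x" and N = "X.D N x"])
        (simp_all add: nonneg)
  qed
  have "AE x in M1. Y.D s1 x = q1 x" "AE x in M1. Y.D s2 x = q2 x"
    using q1 q2 by (simp_all add: Y.distr_density_iff)
  moreover have "AE x in M1. Y.D s x + Y.D (\<lambda>z. g (t1 z) * N z) x = Y.D s1 x + Y.D (\<lambda>z. h (t0 z) * P z) x"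
    by (intro Y.D_add_eq s_eq) auto
  moreover have "AE x in M1. Y.D P x + Y.D P x + Y.D s1 x = Y.D N x + Y.D N x + Y.D s2 x"
    by (intro Y.D_double_add_eq balance) auto
  moreover have "AE x in M1. Y.D (\<lambda>z. h (t0 z) * P z) x \<le> Y.D P x"
    by (intro Y.D_mono) (auto intro: h_P)
  moreover have "AE x in M1. Y.D (\<lambda>z. g (t1 z) * N z) x = g x * Y.D N x"
    by (intro Y.D_mult) auto
  moreover have "AE y in M1. Y.D P y \<noteq> \<infinity>" "AE y in M1. Y.D N y \<noteq> \<infinity>"
    by (intro Y.D_finite fin; measurable)+
  moreover note hg
  ultimately have Dq: "AE y in M1. Y.D s y = ennreal (q y)"
  proof eventually_elim
    case (elim y)
    then show ?case
      unfolding q_def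
      by (intro exchanged_density_target[where b = "Y.D (\<lambda>z. h (t0 z) * P z) y"
            and w = "g y * Y.D N y" and P = "Y.D P y" and N = "Y.D N y"])
        (simp_all add: nonneg)
  qed
  have r_bounds: "r1 x \<le> r2 x \<Longrightarrow> r x = r1 x" "r2 x \<le> r1 x \<Longrightarrow> r2 x \<le> r x \<and> r x \<le> r1 x" for x
    by (auto simp: r_def)
  have q_bounds: "q2 y < q1 y \<Longrightarrow> q y = (q1 y + q2 y) / 2" "q1 y \<le> q2 y \<Longrightarrow> q1 y \<le> q y \<and> q y \<le> q2 y" for y
    by (auto simp: q_def)
  have s_le: "s z \<le> s1 z + s2 z" for z
    using s_between(2)[of z] nonneg(1,2)[of z] by (auto simp: max_def split: if_splits)
  have r_ran: "0 \<le> r x" "r x \<le> r1 x + r2 x" for x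
    using r_bounds[of x] nonneg(3,4)[of x] by linarith+
  have q_ran: "0 \<le> q y" "q y \<le> q1 y + q2 y" for y
    using q_bounds[of y] nonneg(5,6)[of y] by (cases "q2 y < q1 y"; simp)+
  have r: "distr (density L s) M0 t0 = density M0 r"
    using Dr by (subst X.distr_density_iff) auto
  have q: "distr (density L s) M1 t1 = density M1 q"
    using Dq by (subst Y.distr_density_iff) auto
  show ?thesis
  proof (rule that[of s r q])
    show "distr (density L (\<lambda>z. s1 z + s2 z - s z)) M0 t0 = density M0 (\<lambda>x. r1 x + r2 x - r x)"
      by (intro X.distr_density_diff r r1 r2 nonneg s_nonneg s_le r_ran) measurable
    show "distr (density L (\<lambda>z. s1 z + s2 z - s z)) M1 t1 = density M1 (\<lambda>y. q1 y + q2 y - q y)"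
      by (intro Y.distr_density_diff q q1 q2 nonneg s_nonneg s_le q_ran) measurable
    show "s \<in> borel_measurable L" "r \<in> borel_measurable M0" "q \<in> borel_measurable M1"
      by measurable
  qed (fact r q s_between r_bounds q_bounds)+
qed

end

section \<open>Convexity and perspective functions\<close>

text \<open>The integrand of \<open>Hent\<close> when both measures have densities over a common
  reference: jointly convex and positively homogeneous of degree one for convex \<open>h\<close>.
  Division by zero makes it 0 at the origin, as it should be.\<close>

definition perspective :: "(real \<Rightarrow> real) \<Rightarrow> real \<Rightarrow> real \<Rightarrow> real" where
  "perspective h q d = d * h (q / d)"

text \<open>The set on which the perspective is finite: \<open>q / 0\<close> stands for \<open>\<infinity>\<close> unless \<open>q = 0\<close>.\<close>
definition perspective_dom :: "real \<Rightarrow> real \<Rightarrow> bool" where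
  "perspective_dom q d \<longleftrightarrow> 0 \<le> q \<and> 0 \<le> d \<and> (d = 0 \<longrightarrow> q = 0)"

lemma perspective_scale:
  assumes "perspective_dom q d" "0 \<le> a"
  shows "perspective h (a * q) (a * d) = a * perspective h q d"
  using assms by (cases "a = 0") (auto simp: perspective_def)

text \<open>The ratio of the sums is the mean of the ratios q1/d1 and q2/d2 with weights
  proportional to \<open>d1\<close> and \<open>d2\<close>; multiply the convexity inequality by d1 +
  d2. A vanishing base forces the vanishing of its numerator and contributes nothing.\<close>

lemma perspective_subadditive:
  assumes h: "convex_on {0..} h" and "perspective_dom q1 d1" "perspective_dom q2 d2"
  shows "perspective h (q1 + q2) (d1 + d2) \<le> perspective h q1 d1 + perspective h q2 d2"
proof (cases "d1 = 0 \<or> d2 = 0")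
  case False
  then have d: "0 < d1" "0 < d2" and q: "0 \<le> q1" "0 \<le> q2"
    using assms by (auto simp: perspective_dom_def)
  define u where "u = d1 / (d1 + d2)"
  have u: "1 - u = d2 / (d1 + d2)" "0 \<le> u" "u \<le> 1"
    using d by (auto simp: u_def field_simps)
  have "h ((q1 + q2) / (d1 + d2)) = h ((1 - u) *\<^sub>R (q2 / d2) + u *\<^sub>R (q1 / d1))"
    unfolding u(1) unfolding u_def using d by (simp add: add_divide_distrib add.commute)
  also have "\<dots> \<le> (1 - u) * h (q2 / d2) + u * h (q1 / d1)"
    using h u d q by (intro convex_onD) auto
  finally have "(d1 + d2) * h ((q1 + q2) / (d1 + d2))
      \<le> (d1 + d2) * ((1 - u) * h (q2 / d2) + u * h (q1 / d1))"
    using d by (intro mult_left_mono) auto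
  also have "\<dots> = d2 * h (q2 / d2) + d1 * h (q1 / d1)"
    unfolding u(1) unfolding u_def using d by (simp add: distrib_left)
  finally show ?thesis by (simp add: perspective_def)
qed (use assms in \<open>auto simp: perspective_def perspective_dom_def\<close>)

section \<open>Exchange inequalities for perspectives\<close>

definition exchange_improves :: "(real \<Rightarrow> real) \<Rightarrow> real \<Rightarrow> real \<Rightarrow> real \<Rightarrow> real \<Rightarrow> real \<Rightarrow> real \<Rightarrow> bool" where
  "exchange_improves h q1 d1 q2 d2 q d \<longleftrightarrow>
    perspective_dom q d \<and> perspective_dom (q1 + q2 - q) (d1 + d2 - d) \<and>
    perspective h q d + perspective h (q1 + q2 - q) (d1 + d2 - d)
      \<le> perspective h q1 d1 + perspective h q2 d2"

text \<open>Homogeneity frees the weights \<open>a\<close> and \<open>b\<close> from summing to 1.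
  The new pair uses fractions \<open>a\<close>, \<open>b\<close> of the old pairs and its complement
  uses 1 - a, 1 - b, so the two sublinear bounds add up to the old total.\<close>

lemma exchange_improves_parallelogram:
  assumes h: "convex_on {0..} h" and dom: "perspective_dom q1 d1" "perspective_dom q2 d2"
    and ab: "0 \<le> a" "a \<le> 1" "0 \<le> b" "b \<le> 1"
    and "q = a * q1 + b * q2" "d = a * d1 + b * d2"
  shows "exchange_improves h q1 d1 q2 d2 q d"
proof -
  have dom_comb: "perspective_dom (a * q1 + b * q2) (a * d1 + b * d2)"
    and sub: "perspective h (a * q1 + b * q2) (a * d1 + b * d2)
      \<le> a * perspective h q1 d1 + b * perspective h q2 d2"
    if "0 \<le> a" "0 \<le> b" for a b
  proof -
    have dom': "perspective_dom (a * q1) (a * d1)" "perspective_dom (b * q2) (b * d2)"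
      using dom that by (auto simp: perspective_dom_def)
    then show "perspective_dom (a * q1 + b * q2) (a * d1 + b * d2)"
      by (auto simp: perspective_dom_def add_nonneg_eq_0_iff)
    show "perspective h (a * q1 + b * q2) (a * d1 + b * d2)
        \<le> a * perspective h q1 d1 + b * perspective h q2 d2"
      using perspective_subadditive[OF h dom'] perspective_scale[OF dom(1) that(1)]
        perspective_scale[OF dom(2) that(2)] by simp
  qed
  have "q1 + q2 - q = (1 - a) * q1 + (1 - b) * q2" "d1 + d2 - d = (1 - a) * d1 + (1 - b) * d2"
    using assms by (simp_all add: algebra_simps)
  then show ?thesis
    using dom_comb[of a b] dom_comb[of "1 - a" "1 - b"] sub[of a b] sub[of "1 - a" "1 - b"] assms
    by (simp add: exchange_improves_def algebra_simps)
qed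

lemma exchange_improves_diagonal:
  assumes "convex_on {0..} h" "perspective_dom q1 d1" "perspective_dom q2 d2" "0 \<le> t" "t \<le> 1"
  shows "exchange_improves h q1 d1 q2 d2 (q1 + t * (q2 - q1)) (d1 + t * (d2 - d1))"
  by (rule exchange_improves_parallelogram[where a = "1 - t" and b = t])
    (use assms in \<open>auto simp: algebra_simps\<close>)

text \<open>The rectangle spanned by two points in antitone position lies in the parallelogram which they
  span together with the origin.\<close>
lemma exchange_improves_rectangle:
  assumes h: "convex_on {0..} h" and dom: "perspective_dom q1 d1" "perspective_dom q2 d2"
    and "q1 \<le> q" "q \<le> q2" "d2 \<le> d" "d \<le> d1"
  shows "exchange_improves h q1 d1 q2 d2 q d"
proof (cases "q1 * d2 < q2 * d1")
  case True
  let ?D = "q2 * d1 - q1 * d2"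
  have nonneg: "0 \<le> q1" "0 \<le> d1" "0 \<le> q2" "0 \<le> d2"
    using dom by (auto simp: perspective_dom_def)
  have "q2 * d2 \<le> q2 * d" "q * d2 \<le> q2 * d2" "q2 * d \<le> q2 * d1" "q1 * d2 \<le> q * d2"
    "q1 * d1 \<le> q * d1" "q1 * d \<le> q1 * d1" "q * d1 \<le> q2 * d1" "q1 * d2 \<le> q1 * d"
    using assms nonneg by (auto intro: mult_left_mono mult_right_mono)
  then have "0 \<le> q2 * d - q * d2" "q2 * d - q * d2 \<le> ?D" "0 \<le> q * d1 - q1 * d" "q * d1 - q1 * d \<le> ?D"
    by linarith+
  \<comment> \<open>Cramer's rule for (q, d) in the basis of the two given points. The preceding
    products place both coefficients in [0, 1].\<close>
  moreover have "q = (q2 * d - q * d2) / ?D * q1 + (q * d1 - q1 * d) / ?D * q2"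
    "d = (q2 * d - q * d2) / ?D * d1 + (q * d1 - q1 * d) / ?D * d2"
    using True by (simp_all add: divide_simps) (simp_all add: algebra_simps)
  ultimately show ?thesis
    using True
    by (intro exchange_improves_parallelogram[OF h dom, of "(q2 * d - q * d2) / ?D" "(q * d1 - q1 * d) / ?D"])
      (auto simp: divide_le_eq)
next
  case False
  have nonneg: "0 \<le> q1" "0 \<le> d1" "0 \<le> q2" "0 \<le> d2"
    using dom by (auto simp: perspective_dom_def)
  have le: "q1 * d2 \<le> q1 * d1" "q1 * d1 \<le> q2 * d1"
    using assms nonneg by (auto intro: mult_left_mono mult_right_mono)
  \<comment> \<open>Zero determinant forces equality in \<open>le\<close>. Then either the two
    points coincide, or both have vanishing first coordinate and the rectangle is a segment between
    them.\<close>
  show ?thesis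
  proof (cases "d1 = 0 \<or> d1 = d2 \<or> q1 \<noteq> 0")
    case deg: True
    have "d1 = d2 \<and> q1 = q2"
    proof (cases "d1 = 0")
      case True
      then show ?thesis using assms nonneg by (auto simp: perspective_dom_def)
    next
      case d1: False
      have "q1 * d1 = q2 * d1" "q1 * d2 = q1 * d1" using le False by linarith+
      with d1 deg show ?thesis by auto
    qed
    then have "q = 1 * q1 + 0 * q2" "d = 1 * d1 + 0 * d2" using assms by auto
    then show ?thesis by (intro exchange_improves_parallelogram[OF h dom, of 1 0]) auto
  next
    case nd: False
    then have "q2 = 0" using False nonneg by (auto simp: zero_less_mult_iff)
    have "d2 < d1" using nd assms by auto
    define t where "t = (d1 - d) / (d1 - d2)"
    have "0 \<le> t" "t \<le> 1" "t * (d2 - d1) = d - d1"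
      using \<open>d2 < d1\<close> assms by (auto simp: t_def field_simps)
    then show ?thesis
      using exchange_improves_diagonal[OF h dom, of t] \<open>q2 = 0\<close> nd assms by auto
  qed
qed

lemma exchange_improves_swap:
  "exchange_improves h q2 d2 q1 d1 (q1 + q2 - q) (d1 + d2 - d) \<longleftrightarrow> exchange_improves h q1 d1 q2 d2 q d"
  by (auto simp: exchange_improves_def algebra_simps)

lemma convex_mult_ln_minus: "convex_on {0..} (\<lambda>s::real. s * ln s - s)"
proof (rule convex_onI)
  fix t x y :: real
  assume t: "0 < t" "t < 1" and xy: "x \<in> {0..}" "y \<in> {0..}"
  define z where "z = (1 - t) * x + t * y"
  \<comment> \<open>The left side is the tangent at \<open>z\<close>. Averaging the tangent bound at
    \<open>x\<close> and \<open>y\<close> gives convexity; \<open>ln 0 = 0\<close> supplies the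
    right value at s = 0.\<close>
  have tangent: "s * ln z - z \<le> s * ln s - s" if "0 \<le> s" "0 < z" for s
  proof (cases "s = 0")
    case False
    then have "0 < s" using that by simp
    then have "s * (ln z - ln s) \<le> s * (z / s - 1)"
      using ln_le_minus_one[of "z / s"] that by (intro mult_left_mono) (auto simp: ln_div)
    then show ?thesis using \<open>0 < s\<close> by (simp add: algebra_simps)
  qed (use that in simp)
  have "0 \<le> z" using t xy by (auto simp: z_def)
  then consider "z = 0" | "0 < z" by linarith
  then have "z * ln z - z \<le> (1 - t) * (x * ln x - x) + t * (y * ln y - y)"
  proof cases
    case 1
    then have "x = 0" "y = 0" using t xy by (auto simp: z_def add_nonneg_eq_0_iff)
    then show ?thesis using 1 by simp
  next
    case 2
    then have "(1 - t) * (x * ln z - z) + t * (y * ln z - z) \<le> (1 - t) * (x * ln x - x) + t * (y * ln y - y)"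
      using t xy by (intro add_mono mult_left_mono tangent) auto
    moreover have "(1 - t) * (x * ln z - z) + t * (y * ln z - z) = z * ln z - z"
      by (simp add: z_def algebra_simps)
    ultimately show ?thesis by simp
  qed
  then show "((1 - t) *\<^sub>R x + t *\<^sub>R y) * ln ((1 - t) *\<^sub>R x + t *\<^sub>R y) - ((1 - t) *\<^sub>R x + t *\<^sub>R y)
      \<le> (1 - t) * (x * ln x - x) + t * (y * ln y - y)"
    by (simp add: z_def)
qed simp

text \<open>The points \<open>u\<close> and x + y - u mirror each other in the segment: their
  weights are (1 - t, t) and (t, 1 - t), so the two convexity bounds add to h x + h y.\<close>

lemma convex_on_sum_between:
  fixes h :: "real \<Rightarrow> real"
  assumes h: "convex_on S h" and "x \<in> S" "y \<in> S" and u: "min x y \<le> u" "u \<le> max x y"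
  shows "h u + h (x + y - u) \<le> h x + h y"
proof (cases "x = y")
  case False
  define t where "t = (u - x) / (y - x)"
  have t: "0 \<le> t" "t \<le> 1"
    using False u by (auto simp: t_def min_def max_def field_simps split: if_splits)
  have "t * (y - x) = u - x" using False by (simp add: t_def)
  then have ut: "u = (1 - t) *\<^sub>R x + t *\<^sub>R y" by (simp add: algebra_simps)
  then have "x + y - u = (1 - (1 - t)) *\<^sub>R x + (1 - t) *\<^sub>R y"
    by (simp add: algebra_simps)
  then have "h u \<le> (1 - t) * h x + t * h y" "h (x + y - u) \<le> t * h x + (1 - t) * h y"
    using convex_onD[OF h, of t x y] convex_onD[OF h, of "1 - t" x y] assms t ut by auto
  then show ?thesis by (simp add: algebra_simps)
qed (use u in auto)

section \<open>Entropies and densities\<close>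

text \<open>A convex function on the closed half line may jump at 0, so continuity is used on the
  open half line and the value at 0 is glued in.\<close>

lemma measurable_convex_comp:
  fixes h :: "real \<Rightarrow> real"
  assumes h: "convex_on {0..} h" and g [measurable]: "g \<in> borel_measurable M" and pos: "\<And>x. 0 \<le> g x"
  shows "(\<lambda>x. h (g x)) \<in> borel_measurable M"
proof -
  have "continuous_on {0<..} h"
    by (intro convex_on_continuous convex_on_subset[OF h]) auto
  then have [measurable]: "(\<lambda>y. if y \<in> {0<..} then h y else h 0) \<in> borel_measurable borel"
    by (intro borel_measurable_continuous_on_if) auto
  have "(\<lambda>x. h (g x)) = (\<lambda>x. if g x \<in> {0<..} then h (g x) else h 0)"
    using pos by (force simp: fun_eq_iff less_le)
  also have "\<dots> \<in> borel_measurable M"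
    using measurable_compose[OF g \<open>(\<lambda>y. if y \<in> {0<..} then h y else h 0) \<in> _\<close>] by simp
  finally show ?thesis .
qed

lemma finite_measure_density_real:
  fixes f :: "'a \<Rightarrow> real"
  assumes "integrable M f" "\<And>x. 0 \<le> f x"
  shows "finite_measure (density M f)"
proof (rule finite_measureI)
  show "emeasure (density M f) (space (density M f)) \<noteq> \<infinity>"
    using assms by (simp add: emeasure_density nn_integral_eq_integral cong: nn_integral_cong_simp)
qed

lemma (in sigma_finite_measure) obtain_real_density:
  assumes "finite_measure N" "absolutely_continuous M N" and sets: "sets N = sets M"
  obtains f :: "'a \<Rightarrow> real" where "f \<in> borel_measurable M" "\<And>x. 0 \<le> f x" "integrable M f"
    "N = density M f"
proof
  interpret N: finite_measure N by fact
  let ?f = "\<lambda>x. enn2real (RN_deriv M N x)"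
  show "?f \<in> borel_measurable M" by measurable
  show "0 \<le> ?f x" for x by simp
  have "AE x in M. ennreal (?f x) = RN_deriv M N x"
    using RN_deriv_finite[OF _ assms(2) sets] N.sigma_finite_measure_axioms
    by (auto elim!: eventually_mono simp: ennreal_enn2real_if)
  then have "density M ?f = density M (RN_deriv M N)"
    by (intro density_cong) auto
  also have "\<dots> = N"
    using assms by (intro density_RN_deriv)
  finally show eq: "N = density M ?f" by simp
  have "(\<integral>\<^sup>+x. ennreal (?f x) \<partial>M) = emeasure (density M ?f) (space M)"
    by (simp add: emeasure_density cong: nn_integral_cong_simp)
  also have "\<dots> < \<infinity>"
    using N.emeasure_finite[of "space M"] unfolding eq[symmetric] by (simp add: less_top[symmetric])
  finally show "integrable M ?f"
    by (intro integrableI_nonneg) auto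
qed

lemma absolutely_continuous_density_iff:
  fixes a r :: "'a \<Rightarrow> real"
  assumes [measurable]: "a \<in> borel_measurable M" "r \<in> borel_measurable M"
    and pos: "\<And>x. 0 \<le> a x" "\<And>x. 0 \<le> r x"
  shows "absolutely_continuous (density M a) (density M r) \<longleftrightarrow> (AE x in M. perspective_dom (r x) (a x))"
proof
  assume ac: "absolutely_continuous (density M a) (density M r)"
  have "{x\<in>space M. a x = 0} \<in> null_sets (density M a)"
    by (subst null_sets_density_iff) auto
  with ac have "{x\<in>space M. a x = 0} \<in> null_sets (density M r)"
    by (auto simp: absolutely_continuous_def)
  then have "AE x in M. x \<in> {x\<in>space M. a x = 0} \<longrightarrow> ennreal (r x) = 0"
    by (subst (asm) null_sets_density_iff) auto
  with AE_space show "AE x in M. perspective_dom (r x) (a x)"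
  proof eventually_elim
    case (elim x)
    then show ?case using pos[of x] by (auto simp: perspective_dom_def)
  qed
next
  assume dom: "AE x in M. perspective_dom (r x) (a x)"
  show "absolutely_continuous (density M a) (density M r)"
    unfolding absolutely_continuous_def
  proof
    fix B assume "B \<in> null_sets (density M a)"
    then have B: "B \<in> sets M" "AE x in M. x \<in> B \<longrightarrow> ennreal (a x) = 0"
      by (auto simp: null_sets_density_iff)
    from B(2) dom have "AE x in M. x \<in> B \<longrightarrow> ennreal (r x) = 0"
    proof eventually_elim
      case (elim x)
      then show ?case using pos[of x] by (auto simp: perspective_dom_def)
    qed
    then show "B \<in> null_sets (density M r)"
      using B(1) by (auto simp: null_sets_density_iff)
  qed
qed

lemma (in sigma_finite_measure) RN_deriv_density_density:
  fixes a r :: "'a \<Rightarrow> real"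
  assumes [measurable]: "a \<in> borel_measurable M" "r \<in> borel_measurable M"
    and pos: "\<And>x. 0 \<le> a x" "\<And>x. 0 \<le> r x" and "integrable M a"
    and dom: "AE x in M. perspective_dom (r x) (a x)"
  shows "AE x in density M a. RN_deriv (density M a) (density M r) x = ennreal (r x / a x)"
proof -
  interpret A: finite_measure "density M a"
    using assms by (intro finite_measure_density_real)
  have "density (density M a) (\<lambda>x. ennreal (r x / a x)) = density M (\<lambda>x. ennreal (a x) * ennreal (r x / a x))"
    by (subst density_density_eq) auto
  also have "\<dots> = density M r"
  proof (rule density_cong)
    show "AE x in M. ennreal (a x) * ennreal (r x / a x) = ennreal (r x)"
      using dom pos by (auto elim!: eventually_mono simp: ennreal_mult[symmetric] perspective_dom_def)
  qed auto
  finally have "AE x in density M a. ennreal (r x / a x) = RN_deriv (density M a) (density M r) x"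
    by (intro A.RN_deriv_unique) auto
  then show ?thesis by eventually_elim simp
qed

text \<open>The derivative relative to the base \<open>density M a\<close> is r/a, and integrating
  over that base contributes the factor \<open>a\<close>. With one reference measure for all
  entropies, pointwise inequalities between perspectives can be integrated.\<close>

lemma (in sigma_finite_measure) Hent_density:
  fixes a r :: "'a \<Rightarrow> real"
  assumes [measurable]: "a \<in> borel_measurable M" "r \<in> borel_measurable M"
    and pos: "\<And>x. 0 \<le> a x" "\<And>x. 0 \<le> r x" and "integrable M a"
    and dom: "AE x in M. perspective_dom (r x) (a x)" and h: "entropy_fun h"
  shows "Hent h (density M a) (density M r) = enn2ereal (\<integral>\<^sup>+x. ennreal (perspective h (r x) (a x)) \<partial>M)"
proof -
  have convex: "convex_on {0..} h" and h_pos: "\<And>s. 0 \<le> s \<Longrightarrow> 0 \<le> h s"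
    using h by (auto simp: entropy_fun_def)
  have [measurable]: "(\<lambda>x. h (r x / a x)) \<in> borel_measurable M"
    using pos by (intro measurable_convex_comp[OF convex]) auto
  have "(\<integral>\<^sup>+x. ennreal (h (enn2real (RN_deriv (density M a) (density M r) x))) \<partial>density M a)
      = (\<integral>\<^sup>+x. ennreal (h (r x / a x)) \<partial>density M a)"
    using RN_deriv_density_density[OF assms(1-6)] pos
    by (intro nn_integral_cong_AE) (auto elim!: eventually_mono)
  also have "\<dots> = (\<integral>\<^sup>+x. ennreal (perspective h (r x) (a x)) \<partial>M)"
    using pos h_pos
    by (subst nn_integral_density) (auto simp: perspective_def ennreal_mult intro!: nn_integral_cong)
  finally show ?thesis
    using dom absolutely_continuous_density_iff[of a M r] pos by (simp add: Hent_def)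
qed

lemma Hent_nonneg: "0 \<le> Hent h m rho"
  by (simp add: Hent_def)

lemma Hent_finite_imp_absolutely_continuous:
  "Hent h m rho < \<infinity> \<Longrightarrow> sets rho = sets m \<and> absolutely_continuous m rho"
  by (auto simp: Hent_def split: if_splits)

section \<open>A common dominating measure for two plans\<close>

lemma obtain_sum_measure:
  assumes sets: "sets P1 = sets P2"
  obtains L where "sets L = sets P1" "\<And>B. B \<in> sets L \<Longrightarrow> emeasure L B = emeasure P1 B + emeasure P2 B"
proof
  let ?mu = "\<lambda>B. emeasure P1 B + emeasure P2 B"
  let ?L = "measure_of (space P1) (sets P1) ?mu"
  show *: "sets ?L = sets P1" by simp
  show "emeasure ?L B = ?mu B" if B: "B \<in> sets ?L" for B
  proof (rule emeasure_measure_of_sigma)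
    show "sigma_algebra (space P1) (sets P1)" ..
    show "positive (sets P1) ?mu" by (simp add: positive_def)
    show "countably_additive (sets P1) ?mu"
    proof (rule countably_additiveI)
      fix A :: "nat \<Rightarrow> _" assume A: "range A \<subseteq> sets P1" "disjoint_family A"
      then show "(\<Sum>i. ?mu (A i)) = ?mu (\<Union>i. A i)"
        using sets by (subst suminf_add[symmetric]) (auto simp: suminf_emeasure)
    qed
    show "B \<in> sets P1" using B * by simp
  qed
qed

text \<open>Each plan has a marginal with a density, so the preimage of a null set of
  \<open>M\<close> is null for both plans and therefore for their sum \<open>L\<close>.\<close>

lemma marginal_density_sum:
  assumes "sigma_finite_measure M" and t: "t \<in> measurable L M"
    and sets: "sets P1 = sets L" "sets P2 = sets L"
    and sum: "\<And>B. B \<in> sets L \<Longrightarrow> emeasure L B = emeasure P1 B + emeasure P2 B"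
    and r: "r1 \<in> borel_measurable M" "r2 \<in> borel_measurable M"
      "distr P1 M t = density M r1" "distr P2 M t = density M r2"
  shows "marginal_density M L t"
proof -
  have "absolutely_continuous M (distr L M t)"
    unfolding absolutely_continuous_def
  proof
    fix B assume B: "B \<in> null_sets M"
    then have pre: "t -` B \<inter> space L \<in> sets L" using t by auto
    have sp: "space P1 = space L" "space P2 = space L" using sets by (auto dest: sets_eq_imp_space_eq)
    have m: "t \<in> measurable P1 M" "t \<in> measurable P2 M"
      using t sets by (simp_all cong: measurable_cong_sets)
    have "B \<in> null_sets (density M r1)" "B \<in> null_sets (density M r2)"
      using B absolutely_continuousI_density r by (auto simp: absolutely_continuous_def)
    then have "t -` B \<inter> space L \<in> null_sets P1" "t -` B \<inter> space L \<in> null_sets P2"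
      using m by (simp_all add: r(3,4)[symmetric] null_sets_distr_iff sp)
    then have "t -` B \<inter> space L \<in> null_sets L"
      using pre by (auto simp: null_sets_def sum)
    then show "B \<in> null_sets (distr L M t)"
      using B t by (auto simp: null_sets_distr_iff)
  qed
  then show ?thesis
    using assms by (simp add: marginal_density_def marginal_density_axioms_def)
qed

lemma integral_density_exchange:
  fixes c s1 s2 s :: "'a \<Rightarrow> real"
  assumes [measurable]: "s1 \<in> borel_measurable L" "s2 \<in> borel_measurable L" "s \<in> borel_measurable L"
      "c \<in> borel_measurable L"
    and pos: "\<And>z. 0 \<le> s1 z" "\<And>z. 0 \<le> s2 z"
    and between: "\<And>z. min (s1 z) (s2 z) \<le> s z" "\<And>z. s z \<le> max (s1 z) (s2 z)"
    and int: "integrable (density L s1) c" "integrable (density L s2) c"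
  shows "integral\<^sup>L (density L s) c + integral\<^sup>L (density L (\<lambda>z. s1 z + s2 z - s z)) c
    = integral\<^sup>L (density L s1) c + integral\<^sup>L (density L s2) c"
proof -
  have s: "0 \<le> s z" "s z \<le> s1 z + s2 z" for z
    using pos[of z] between[of z] by (auto simp: min_def max_def split: if_splits)
  have i: "integrable L (\<lambda>z. s1 z * c z)" "integrable L (\<lambda>z. s2 z * c z)"
    using int pos by (simp_all add: integrable_density)
  have s_int: "integrable L (\<lambda>z. s z * c z)"
  proof (rule Bochner_Integration.integrable_bound)
    show "integrable L (\<lambda>z. \<bar>s1 z * c z\<bar> + \<bar>s2 z * c z\<bar>)" using i by auto
    have "\<bar>s z\<bar> * \<bar>c z\<bar> \<le> (\<bar>s1 z\<bar> + \<bar>s2 z\<bar>) * \<bar>c z\<bar>" for z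
      using s[of z] pos[of z] by (intro mult_right_mono) auto
    then show "AE z in L. norm (s z * c z) \<le> norm (\<bar>s1 z * c z\<bar> + \<bar>s2 z * c z\<bar>)"
      by (auto simp: abs_mult distrib_right)
  qed measurable
  have "integral\<^sup>L (density L (\<lambda>z. s1 z + s2 z - s z)) c = (\<integral>z. (s1 z + s2 z - s z) * c z \<partial>L)"
    using s by (subst integral_density) auto
  also have "\<dots> = (\<integral>z. s1 z * c z \<partial>L) + (\<integral>z. s2 z * c z \<partial>L) - (\<integral>z. s z * c z \<partial>L)"
    using i s_int by (simp add: algebra_simps)
  finally show ?thesis using s pos by (simp add: integral_density)
qed

section \<open>Finite Borel measures and plans on compact spaces\<close>

lemma space_fin_meas: "M \<in> fin_meas A \<Longrightarrow> space M = A"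
  unfolding fin_meas_def by (auto dest: sets_eq_imp_space_eq simp: space_restrict_space)

lemma space_prod_borel: "space (prod_borel A B) = A \<times> B"
  by (simp add: prod_borel_def space_pair_measure space_restrict_space)

lemma space_fin_meas_prod: "P \<in> fin_meas_prod A B \<Longrightarrow> space P = A \<times> B"
  unfolding fin_meas_prod_def by (auto dest: sets_eq_imp_space_eq simp: space_prod_borel)

lemma finite_measure_fin_meas: "M \<in> fin_meas A \<Longrightarrow> finite_measure M"
  using space_fin_meas[of M A] by (intro finite_measureI) (auto simp: fin_meas_def)

lemma finite_measure_fin_meas_prod: "P \<in> fin_meas_prod A B \<Longrightarrow> finite_measure P"
  using space_fin_meas_prod[of P A B] by (intro finite_measureI) (auto simp: fin_meas_prod_def)

lemma fin_measI:
  "finite_measure M \<Longrightarrow> sets M = sets (restrict_space borel A) \<Longrightarrow> M \<in> fin_meas A"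
  using finite_measure.emeasure_finite[of M A] by (simp add: fin_meas_def less_top[symmetric])

lemma fin_meas_prodI:
  "finite_measure P \<Longrightarrow> sets P = sets (prod_borel A B) \<Longrightarrow> P \<in> fin_meas_prod A B"
  using finite_measure.emeasure_finite[of P "A \<times> B"] by (simp add: fin_meas_prod_def less_top[symmetric])

lemma marg0_eq_distr:
  "sets M = sets (restrict_space borel A) \<Longrightarrow> marg0 A P = distr P M fst"
  unfolding marg0_def by (intro distr_cong) auto

lemma marg1_eq_distr:
  "sets M = sets (restrict_space borel B) \<Longrightarrow> marg1 B P = distr P M snd"
  unfolding marg1_def by (intro distr_cong) auto

text \<open>The ambient metric spaces need not be second countable, so joint measurability with respect to
  the product \<open>\<sigma>\<close>-algebra is obtained by approximating \<open>c\<close> uniformly with functions that depend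
  on the first variable only through a finite Borel partition.\<close>
lemma borel_measurable_prod_borel_continuous:
  fixes c :: "'a::metric_space \<times> 'b::metric_space \<Rightarrow> real"
  assumes A: "compact A" and B: "compact B" and c: "continuous_on (A \<times> B) c"
  shows "c \<in> borel_measurable (prod_borel A B)"
proof -
  have "uniformly_continuous_on (A \<times> B) c"
    by (intro compact_uniformly_continuous c compact_Times A B)
  then have "\<exists>d>0. \<forall>z\<in>A \<times> B. \<forall>z'\<in>A \<times> B. dist z' z < d \<longrightarrow> dist (c z') (c z) < 1 / real (Suc n)" for n
    by (auto simp: uniformly_continuous_on_def)
  then obtain d where d: "\<And>n. 0 < d n"
    and unif: "\<And>n z z'. z \<in> A \<times> B \<Longrightarrow> z' \<in> A \<times> B \<Longrightarrow> dist z' z < d n \<Longrightarrow> dist (c z') (c z) < 1 / real (Suc n)"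
    by metis
  have "\<exists>xs. set xs \<subseteq> A \<and> A \<subseteq> (\<Union>x\<in>set xs. ball x (d n))" for n
    using compact_imp_seq_compact[OF A, THEN seq_compact_imp_totally_bounded] d[of n]
    by (metis finite_list)
  then obtain xs where xs: "\<And>n. set (xs n) \<subseteq> A" "\<And>n. A \<subseteq> (\<Union>x\<in>set (xs n). ball x (d n))"
    by metis
  define near where "near n i x \<longleftrightarrow> i < length (xs n) \<and> x \<in> ball (xs n ! i) (d n)" for n i x
  define k where "k n x = (LEAST i. near n i x)" for n x
  have near_k: "near n (k n x) x" if "x \<in> A" for n x
    unfolding k_def
  proof (rule LeastI_ex)
    show "\<exists>i. near n i x"
      using xs(2)[of n] that by (fastforce simp: near_def in_set_conv_nth)
  qed
  \<comment> \<open>Outside \<open>A\<close> possibly no ball contains the point and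
    \<open>LEAST\<close> is then unspecified; the guard keeps the index within the list.\<close>
  define cn where "cn n z = (if k n (fst z) < length (xs n) then c (xs n ! k n (fst z), snd z) else 0)" for n z
  let ?P = "prod_borel A B"
  have [measurable]: "fst \<in> measurable ?P (restrict_space borel A)" "snd \<in> measurable ?P (restrict_space borel B)"
    by (auto simp: prod_borel_def)
  have "cn n \<in> borel_measurable ?P" for n
  proof -
    have "Measurable.pred (restrict_space borel A) (\<lambda>x. near n i x)" for i
      unfolding near_def
      by (intro pred_intros_logic measurable_restrict_space1) (simp_all add: pred_def del: mem_ball)
    then have "k n \<in> measurable (restrict_space borel A) (count_space UNIV)"
      unfolding k_def[abs_def] by (intro measurable_Least)
    then have k: "(\<lambda>z. k n (fst z)) \<in> measurable ?P (count_space UNIV)"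
      by measurable
    have "(\<lambda>z. if i < length (xs n) then c (xs n ! i, snd z) else 0) \<in> borel_measurable ?P" for i
    proof (cases "i < length (xs n)")
      case True
      then have "xs n ! i \<in> A" using xs(1)[of n] by auto
      then have "continuous_on B (\<lambda>y. c (xs n ! i, y))"
        by (intro continuous_on_compose2[OF c] continuous_intros) auto
      then have [measurable]: "(\<lambda>y. c (xs n ! i, y)) \<in> borel_measurable (restrict_space borel B)"
        by (rule borel_measurable_continuous_on_restrict)
      show ?thesis using True by simp
    qed simp
    then show ?thesis
      unfolding cn_def[abs_def] by (rule measurable_compose_countable[OF _ k])
  qed
  moreover have "(\<lambda>n. cn n z) \<longlonglongrightarrow> c z" if z_in: "z \<in> space ?P" for z
  proof -
    obtain x y where z: "z = (x, y)" "x \<in> A" "y \<in> B"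
      using z_in by (auto simp: space_prod_borel)
    have bound: "dist (cn n z) (c z) \<le> 1 / real (Suc n)" for n
    proof -
      have n: "k n x < length (xs n)" "dist (xs n ! k n x) x < d n"
        using near_k[OF z(2), of n] by (auto simp: near_def dist_commute)
      then have "xs n ! k n x \<in> A" using xs(1)[of n] by auto
      then have "dist (c (xs n ! k n x, y)) (c z) < 1 / real (Suc n)"
        using z n by (intro unif) (auto simp: dist_Pair_Pair)
      then show ?thesis using n by (simp add: cn_def z)
    qed
    have "(\<lambda>n. dist (cn n z) (c z)) \<longlonglongrightarrow> 0"
    proof (rule Lim_null_comparison)
      show "(\<lambda>n. 1 / real (Suc n)) \<longlonglongrightarrow> 0"
        using LIMSEQ_inverse_real_of_nat by (simp add: inverse_eq_divide)
      show "\<forall>\<^sub>F n in sequentially. norm (dist (cn n z) (c z)) \<le> 1 / real (Suc n)"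
        using bound by (intro always_eventually) simp
    qed
    then show ?thesis by (rule tendsto_dist_iff[THEN iffD2])
  qed
  ultimately show ?thesis
    by (rule borel_measurable_LIMSEQ_real[rotated])
qed

lemma plan_cost_bound:
  fixes c :: "'a::metric_space \<times> 'b::metric_space \<Rightarrow> real"
  assumes A: "compact A" and B: "compact B" and c: "continuous_on (A \<times> B) c"
  obtains C where "0 \<le> C"
    "\<And>P. P \<in> fin_meas_prod A B \<Longrightarrow> integrable P c \<and> - (C * measure P (A \<times> B)) \<le> integral\<^sup>L P c"
proof -
  have "bounded (c ` (A \<times> B))"
    by (intro compact_imp_bounded compact_continuous_image c compact_Times A B)
  then obtain C where C: "0 < C" "\<And>z. z \<in> A \<times> B \<Longrightarrow> \<bar>c z\<bar> \<le> C"
    by (auto simp: bounded_pos)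
  show ?thesis
  proof (rule that[of C])
    fix P :: "('a \<times> 'b) measure" assume P: "P \<in> fin_meas_prod A B"
    interpret finite_measure P by (rule finite_measure_fin_meas_prod[OF P])
    have "sets P = sets (prod_borel A B)" using P by (simp add: fin_meas_prod_def)
    then have [measurable]: "c \<in> borel_measurable P"
      using borel_measurable_prod_borel_continuous[OF A B c] by (simp cong: measurable_cong_sets)
    have sp: "space P = A \<times> B" by (rule space_fin_meas_prod[OF P])
    have int: "integrable P c"
      by (intro integrable_const_bound[of _ C] AE_I2) (auto simp: sp C)
    have "(\<integral>z. - C \<partial>P) \<le> integral\<^sup>L P c"
    proof (rule integral_mono[OF _ int])
      show "- C \<le> c z" if "z \<in> space P" for z
        using C(2)[of z] that sp by auto
    qed simp
    with int show "integrable P c \<and> - (C * measure P (A \<times> B)) \<le> integral\<^sup>L P c"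
      by (simp add: sp mult.commute)
  qed (use C in simp)
qed

lemma meas_le_obtain_density:
  assumes "finite_measure M" "finite_measure N" and sets: "sets N = sets M" and le: "meas_le N M"
  obtains a :: "'a \<Rightarrow> real" where "a \<in> borel_measurable M" "\<And>x. 0 \<le> a x" "\<And>x. a x \<le> 1"
    "N = density M a"
proof -
  interpret M: finite_measure M by fact
  have ac: "absolutely_continuous M N"
    unfolding absolutely_continuous_def
  proof
    fix B assume "B \<in> null_sets M"
    then show "B \<in> null_sets N"
      using le sets by (auto simp: meas_le_def null_sets_def)
  qed
  obtain b :: "'a \<Rightarrow> real" where [measurable]: "b \<in> borel_measurable M"
    and b: "\<And>x. 0 \<le> b x" "N = density M b"
    using M.obtain_real_density[OF assms(2) ac sets] by metis
  \<comment> \<open>On \<open>B\<close> the density splits as 1 plus b - 1, while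
    \<open>ennreal (b x - 1)\<close> is zero off \<open>B\<close>. So the mass of \<open>N\<close>
    on \<open>B\<close> is that of \<open>M\<close> plus the integral of the positive part of b - 1,
    and domination together with finiteness makes that integral vanish.\<close>
  define B where "B = {x \<in> space M. 1 < b x}"
  have [measurable]: "B \<in> sets M" by (simp add: B_def)
  have "emeasure M B + (\<integral>\<^sup>+x. ennreal (b x - 1) \<partial>M) = (\<integral>\<^sup>+x. indicator B x + ennreal (b x - 1) \<partial>M)"
    by (subst nn_integral_add) auto
  also have "\<dots> = (\<integral>\<^sup>+x. ennreal (b x) * indicator B x \<partial>M)"
  proof (rule nn_integral_cong)
    fix x assume "x \<in> space M"
    then show "indicator B x + ennreal (b x - 1) = ennreal (b x) * indicator B x"
      using ennreal_plus[of 1 "b x - 1"] by (cases "1 < b x") (simp_all add: B_def ennreal_neg)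
  qed
  also have "\<dots> = emeasure N B" by (simp add: b(2) emeasure_density)
  also have "\<dots> \<le> emeasure M B" using le by (simp add: meas_le_def sets)
  finally have "(\<integral>\<^sup>+x. ennreal (b x - 1) \<partial>M) = 0"
    using M.emeasure_finite[of B]
    by (cases "emeasure M B"; cases "\<integral>\<^sup>+x. ennreal (b x - 1) \<partial>M")
      (auto simp: top_unique ennreal_plus[symmetric] simp del: ennreal_plus)
  then have "AE x in M. b x \<le> 1"
    by (subst (asm) nn_integral_0_iff_AE) (auto simp: ennreal_eq_0_iff)
  then have "N = density M (\<lambda>x. min (b x) 1)"
    unfolding b(2) by (intro density_cong) (auto elim!: eventually_mono simp: min_def)
  then show ?thesis
    using b(1) by (intro that[of "\<lambda>x. min (b x) 1"]) auto
qed

lemma (in sigma_finite_measure) Hent_exchange: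
  fixes q1 q2 q d1 d2 d :: "'a \<Rightarrow> real"
  assumes h: "entropy_fun h"
    and [measurable]: "q1 \<in> borel_measurable M" "q2 \<in> borel_measurable M" "q \<in> borel_measurable M"
    and d: "integrable M d1" "integrable M d2" "integrable M d"
    and pos: "\<And>x. 0 \<le> q1 x" "\<And>x. 0 \<le> q2 x" "\<And>x. 0 \<le> q x" "\<And>x. q x \<le> q1 x + q2 x"
      "\<And>x. 0 \<le> d1 x" "\<And>x. 0 \<le> d2 x" "\<And>x. 0 \<le> d x" "\<And>x. d x \<le> d1 x + d2 x"
    and dom: "AE x in M. perspective_dom (q1 x) (d1 x)" "AE x in M. perspective_dom (q2 x) (d2 x)"
    and ex: "AE x in M. exchange_improves h (q1 x) (d1 x) (q2 x) (d2 x) (q x) (d x)"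
  shows "Hent h (density M d) (density M q)
      + Hent h (density M (\<lambda>x. d1 x + d2 x - d x)) (density M (\<lambda>x. q1 x + q2 x - q x))
    \<le> Hent h (density M d1) (density M q1) + Hent h (density M d2) (density M q2)"
proof -
  have [measurable]: "d1 \<in> borel_measurable M" "d2 \<in> borel_measurable M" "d \<in> borel_measurable M"
    using d by auto
  have convex: "convex_on {0..} h" and h_pos: "\<And>s. 0 \<le> s \<Longrightarrow> 0 \<le> h s"
    using h by (auto simp: entropy_fun_def)
  have H: "Hent h (density M b) (density M p) = enn2ereal (\<integral>\<^sup>+x. ennreal (perspective h (p x) (b x)) \<partial>M)"
    if "integrable M b" "p \<in> borel_measurable M" "\<And>x. 0 \<le> p x" "\<And>x. 0 \<le> b x"
      "AE x in M. perspective_dom (p x) (b x)" for p b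
    using that h by (intro Hent_density) auto
  have meas: "(\<lambda>x. perspective h (p x) (b x)) \<in> borel_measurable M"
    if [measurable]: "p \<in> borel_measurable M" "b \<in> borel_measurable M" and "\<And>x. 0 \<le> p x" "\<And>x. 0 \<le> b x" for p b
  proof -
    have [measurable]: "(\<lambda>x. h (p x / b x)) \<in> borel_measurable M"
      using that by (intro measurable_convex_comp[OF convex]) auto
    show ?thesis unfolding perspective_def by measurable
  qed
  have persp_pos: "0 \<le> perspective h p b" if "perspective_dom p b" for p b
    using that h_pos by (auto simp: perspective_def perspective_dom_def)
  have dom': "AE x in M. perspective_dom (q x) (d x)"
    "AE x in M. perspective_dom (q1 x + q2 x - q x) (d1 x + d2 x - d x)"
    using ex by (auto elim!: eventually_mono simp: exchange_improves_def)
  have [measurable]: "(\<lambda>x. perspective h (q x) (d x)) \<in> borel_measurable M"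
    "(\<lambda>x. perspective h (q1 x + q2 x - q x) (d1 x + d2 x - d x)) \<in> borel_measurable M"
    "(\<lambda>x. perspective h (q1 x) (d1 x)) \<in> borel_measurable M"
    "(\<lambda>x. perspective h (q2 x) (d2 x)) \<in> borel_measurable M"
    using pos by (auto intro!: meas)
  have "(\<integral>\<^sup>+x. ennreal (perspective h (q x) (d x)) \<partial>M)
      + (\<integral>\<^sup>+x. ennreal (perspective h (q1 x + q2 x - q x) (d1 x + d2 x - d x)) \<partial>M)
    = (\<integral>\<^sup>+x. ennreal (perspective h (q x) (d x))
        + ennreal (perspective h (q1 x + q2 x - q x) (d1 x + d2 x - d x)) \<partial>M)"
    by (rule nn_integral_add[symmetric]) auto
  also have "\<dots> \<le> (\<integral>\<^sup>+x. ennreal (perspective h (q1 x) (d1 x)) + ennreal (perspective h (q2 x) (d2 x)) \<partial>M)"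
    using ex dom
  proof (intro nn_integral_mono_AE, eventually_elim)
    case (elim x)
    then show ?case
      using persp_pos by (auto simp: exchange_improves_def ennreal_plus[symmetric] simp del: ennreal_plus
          intro!: ennreal_leI)
  qed
  also have "\<dots> = (\<integral>\<^sup>+x. ennreal (perspective h (q1 x) (d1 x)) \<partial>M)
      + (\<integral>\<^sup>+x. ennreal (perspective h (q2 x) (d2 x)) \<partial>M)"
    by (rule nn_integral_add) auto
  finally show ?thesis
    using d pos dom dom' by (simp add: H plus_ennreal.rep_eq[symmetric] less_eq_ennreal.rep_eq[symmetric])
qed

section \<open>Exchange for the transport costs\<close>

lemma integrable_of_finite_density:
  fixes s :: "'a \<Rightarrow> real"
  assumes [measurable]: "s \<in> borel_measurable L" and "\<And>z. 0 \<le> s z" "finite_measure (density L s)"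
  shows "integrable L s"
proof (rule integrableI_nonneg)
  have "(\<integral>\<^sup>+z. ennreal (s z) \<partial>L) = emeasure (density L s) (space L)"
    by (simp add: emeasure_density cong: nn_integral_cong_simp)
  then show "(\<integral>\<^sup>+z. ennreal (s z) \<partial>L) < \<infinity>"
    using finite_measure.emeasure_finite[OF assms(3), of "space L"] by (simp add: less_top[symmetric])
qed (use assms in auto)

lemma plan_exchange_fin_meas_prod:
  fixes mu :: "'a::metric_space measure" and m :: "'b::metric_space measure"
    and s1 s2 :: "'a \<times> 'b \<Rightarrow> real" and r1 r2 :: "'a \<Rightarrow> real" and q1 q2 :: "'b \<Rightarrow> real"
  assumes mu: "mu \<in> fin_meas A" and m: "m \<in> fin_meas B"
    and plans: "density L s1 \<in> fin_meas_prod A B" "density L s2 \<in> fin_meas_prod A B"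
    and sum: "\<And>C. C \<in> sets L \<Longrightarrow> emeasure L C = emeasure (density L s1) C + emeasure (density L s2) C"
    and s [measurable]: "s1 \<in> borel_measurable L" "s2 \<in> borel_measurable L"
    and s_nonneg: "\<And>z. 0 \<le> s1 z" "\<And>z. 0 \<le> s2 z"
    and rq_meas: "r1 \<in> borel_measurable mu" "r2 \<in> borel_measurable mu"
      "q1 \<in> borel_measurable m" "q2 \<in> borel_measurable m"
    and nonneg: "\<And>x. 0 \<le> r1 x" "\<And>x. 0 \<le> r2 x" "\<And>y. 0 \<le> q1 y" "\<And>y. 0 \<le> q2 y"
    and marg: "marg0 A (density L s1) = density mu r1" "marg0 A (density L s2) = density mu r2"
      "marg1 B (density L s1) = density m q1" "marg1 B (density L s2) = density m q2"
  obtains s r q :: "_ \<Rightarrow> real" where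
    "s \<in> borel_measurable L" "r \<in> borel_measurable mu" "q \<in> borel_measurable m"
    "\<And>z. min (s1 z) (s2 z) \<le> s z" "\<And>z. s z \<le> max (s1 z) (s2 z)"
    "density L s \<in> fin_meas_prod A B" "density L (\<lambda>z. s1 z + s2 z - s z) \<in> fin_meas_prod A B"
    "marg0 A (density L s) = density mu r"
    "marg0 A (density L (\<lambda>z. s1 z + s2 z - s z)) = density mu (\<lambda>x. r1 x + r2 x - r x)"
    "marg1 B (density L s) = density m q"
    "marg1 B (density L (\<lambda>z. s1 z + s2 z - s z)) = density m (\<lambda>y. q1 y + q2 y - q y)"
    "\<And>x. r1 x \<le> r2 x \<Longrightarrow> r x = r1 x"
    "\<And>x. r2 x \<le> r1 x \<Longrightarrow> r2 x \<le> r x \<and> r x \<le> r1 x"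
    "\<And>y. q2 y < q1 y \<Longrightarrow> q y = (q1 y + q2 y) / 2"
    "\<And>y. q1 y \<le> q2 y \<Longrightarrow> q1 y \<le> q y \<and> q y \<le> q2 y"
proof -
  have sets_L: "sets L = sets (prod_borel A B)"
    using plans(1) by (simp add: fin_meas_prod_def)
  have sets_mu: "sets mu = sets (restrict_space borel A)" and sets_m: "sets m = sets (restrict_space borel B)"
    using mu m by (auto simp: fin_meas_def)
  have "fst \<in> measurable (prod_borel A B) (restrict_space borel A)"
    "snd \<in> measurable (prod_borel A B) (restrict_space borel B)"
    by (auto simp: prod_borel_def)
  then have proj: "fst \<in> measurable L mu" "snd \<in> measurable L m"
    using sets_L sets_mu sets_m by (simp_all cong: measurable_cong_sets)
  note margs = marg[unfolded marg0_eq_distr[OF sets_mu] marg1_eq_distr[OF sets_m]]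
  have sf: "sigma_finite_measure mu" "sigma_finite_measure m"
    using mu m by (auto intro!: finite_measure.axioms(1) finite_measure_fin_meas)
  interpret two_marginals mu m L fst snd
  proof (unfold two_marginals_def, intro conjI)
    show "marginal_density mu L fst"
      by (rule marginal_density_sum[OF sf(1) proj(1) _ _ sum _ _ margs(1,2)]) (use rq_meas in simp_all)
    show "marginal_density m L snd"
      by (rule marginal_density_sum[OF sf(2) proj(2) _ _ sum _ _ margs(3,4)]) (use rq_meas in simp_all)
  qed
  have int: "integrable L s1" "integrable L s2"
    using plans s_nonneg by (auto intro!: integrable_of_finite_density finite_measure_fin_meas_prod)
  obtain s r q :: "_ \<Rightarrow> real" where [measurable]: "s \<in> borel_measurable L"
      "r \<in> borel_measurable mu" "q \<in> borel_measurable m"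
    and between: "\<And>z. min (s1 z) (s2 z) \<le> s z" "\<And>z. s z \<le> max (s1 z) (s2 z)"
    and dist: "distr (density L s) mu fst = density mu r"
      "distr (density L (\<lambda>z. s1 z + s2 z - s z)) mu fst = density mu (\<lambda>x. r1 x + r2 x - r x)"
      "distr (density L s) m snd = density m q"
      "distr (density L (\<lambda>z. s1 z + s2 z - s z)) m snd = density m (\<lambda>y. q1 y + q2 y - q y)"
    and rq: "\<And>x. r1 x \<le> r2 x \<Longrightarrow> r x = r1 x"
      "\<And>x. r2 x \<le> r1 x \<Longrightarrow> r2 x \<le> r x \<and> r x \<le> r1 x"
      "\<And>y. q2 y < q1 y \<Longrightarrow> q y = (q1 y + q2 y) / 2"
      "\<And>y. q1 y \<le> q2 y \<Longrightarrow> q1 y \<le> q y \<and> q y \<le> q2 y"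
    by (rule plan_exchange[OF s rq_meas s_nonneg nonneg int margs]) blast
  have s: "0 \<le> s z" "s z \<le> s1 z + s2 z" for z
    using s_nonneg[of z] between[of z] by (auto simp: min_def max_def split: if_splits)
  have "integrable L s"
    using s by (intro Bochner_Integration.integrable_bound[OF Bochner_Integration.integrable_add[OF int]])
      (auto intro!: AE_I2 simp: order_trans[OF s(2) abs_ge_self])
  then have "density L s \<in> fin_meas_prod A B" "density L (\<lambda>z. s1 z + s2 z - s z) \<in> fin_meas_prod A B"
    using s int by (auto intro!: fin_meas_prodI finite_measure_density_real simp: sets_L)
  note new = this
  show ?thesis
    by (rule that[of s r q])
      (simp_all add: between new dist rq marg0_eq_distr[OF sets_mu] marg1_eq_distr[OF sets_m])
qed

lemma obtain_common_density:
  assumes P: "P1 \<in> fin_meas_prod A B" "P2 \<in> fin_meas_prod A B"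
  obtains L and s1 s2 :: "_ \<Rightarrow> real" where
    "s1 \<in> borel_measurable L" "s2 \<in> borel_measurable L" "\<And>z. 0 \<le> s1 z" "\<And>z. 0 \<le> s2 z"
    "P1 = density L s1" "P2 = density L s2"
    "\<And>C. C \<in> sets L \<Longrightarrow> emeasure L C = emeasure P1 C + emeasure P2 C"
proof -
  have sets: "sets P1 = sets P2" using P by (simp add: fin_meas_prod_def)
  interpret P1: finite_measure P1 using P by (intro finite_measure_fin_meas_prod)
  interpret P2: finite_measure P2 using P by (intro finite_measure_fin_meas_prod)
  obtain L where L: "sets L = sets P1"
    "\<And>C. C \<in> sets L \<Longrightarrow> emeasure L C = emeasure P1 C + emeasure P2 C"
    by (rule obtain_sum_measure[OF sets]) blast
  interpret L: finite_measure L
    by (rule finite_measureI) (simp add: L(2))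
  have ac: "absolutely_continuous L P1" "absolutely_continuous L P2"
    using L sets by (auto simp: absolutely_continuous_def null_sets_def)
  obtain s1 :: "_ \<Rightarrow> real" where s1: "s1 \<in> borel_measurable L" "\<And>z. 0 \<le> s1 z" "P1 = density L s1"
    using L.obtain_real_density[OF P1.finite_measure_axioms ac(1)] L(1) by metis
  obtain s2 :: "_ \<Rightarrow> real" where s2: "s2 \<in> borel_measurable L" "\<And>z. 0 \<le> s2 z" "P2 = density L s2"
    using L.obtain_real_density[OF P2.finite_measure_axioms ac(2)] L(1) sets by metis
  show ?thesis
    by (rule that[OF s1(1) s2(1) s1(2) s2(2) s1(3) s2(3) L(2)])
qed

section \<open>The exchange property, and costs with prescribed marginals\<close>

definition partially_swapped :: "('b \<Rightarrow> real) \<Rightarrow> ('b \<Rightarrow> real) \<Rightarrow> ('b \<Rightarrow> real) \<Rightarrow> bool" where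
  "partially_swapped d1 d2 d \<longleftrightarrow> (\<forall>y. if d2 y < d1 y then d y = (d1 y + d2 y) / 2 else d1 y \<le> d y \<and> d y \<le> d2 y)"

text \<open>The real bounds \<open>e1\<close> and \<open>e2\<close> stand for nearly optimal plans:
  a strict bound on an infimum provides a plan below it even when the infimum is not attained.
  Together with never being minus infinity, this is all that the comparison of minimizers asks of a
  cost.\<close>

definition exchangeable :: "'a::topological_space set \<Rightarrow> ('a measure \<Rightarrow> 'b measure \<Rightarrow> ereal) \<Rightarrow> 'b measure \<Rightarrow> bool" where
  "exchangeable A T m \<longleftrightarrow> (\<forall>mu1\<in>fin_meas A. \<forall>mu2\<in>fin_meas A. \<forall>(d1 :: 'b \<Rightarrow> real) (d2 :: 'b \<Rightarrow> real) (e1 :: real) (e2 :: real).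
    meas_le mu1 mu2 \<longrightarrow> integrable m d1 \<longrightarrow> integrable m d2 \<longrightarrow> (\<forall>y. 0 \<le> d1 y) \<longrightarrow> (\<forall>y. 0 \<le> d2 y) \<longrightarrow>
    T mu1 (density m d1) < ereal e1 \<longrightarrow> T mu2 (density m d2) < ereal e2 \<longrightarrow>
    (\<exists>d\<in>borel_measurable m. partially_swapped d1 d2 d \<and>
      T mu1 (density m d) + T mu2 (density m (\<lambda>y. d1 y + d2 y - d y)) \<le> ereal (e1 + e2)))"

text \<open>Relative to \<open>mu2\<close> the first marginals have densities \<open>a\<close> and 1
  with a \<le> 1. This is the regime in which the exchange returns at each source all that it
  removes, so both new plans keep their first marginals.\<close>

lemma coupling_exchange:
  fixes mu1 mu2 :: "'a::metric_space measure" and m :: "'b::metric_space measure"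
    and d1 d2 :: "'b \<Rightarrow> real" and s1 s2 :: "'a \<times> 'b \<Rightarrow> real"
  assumes mu: "mu1 \<in> fin_meas A" "mu2 \<in> fin_meas A" and le: "meas_le mu1 mu2" and m: "m \<in> fin_meas B"
    and d_meas: "d1 \<in> borel_measurable m" "d2 \<in> borel_measurable m"
    and d: "\<And>y. 0 \<le> d1 y" "\<And>y. 0 \<le> d2 y"
    and s: "s1 \<in> borel_measurable L" "s2 \<in> borel_measurable L"
    and s_nonneg: "\<And>z. 0 \<le> s1 z" "\<And>z. 0 \<le> s2 z"
    and P: "density L s1 \<in> couplings A B mu1 (density m d1)" "density L s2 \<in> couplings A B mu2 (density m d2)"
    and sum: "\<And>C. C \<in> sets L \<Longrightarrow> emeasure L C = emeasure (density L s1) C + emeasure (density L s2) C"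
  obtains s d :: "_ \<Rightarrow> real" where "s \<in> borel_measurable L" "d \<in> borel_measurable m"
    "\<And>z. min (s1 z) (s2 z) \<le> s z" "\<And>z. s z \<le> max (s1 z) (s2 z)"
    "density L s \<in> couplings A B mu1 (density m d)"
    "density L (\<lambda>z. s1 z + s2 z - s z) \<in> couplings A B mu2 (density m (\<lambda>y. d1 y + d2 y - d y))"
    "partially_swapped d1 d2 d"
proof -
  have fin: "finite_measure mu1" "finite_measure mu2" and sets: "sets mu1 = sets mu2"
    using mu by (auto simp: fin_meas_def intro: finite_measure_fin_meas)
  obtain a :: "'a \<Rightarrow> real" where a: "a \<in> borel_measurable mu2" "\<And>x. 0 \<le> a x" "\<And>x. a x \<le> 1" "mu1 = density mu2 a"
    by (rule meas_le_obtain_density[OF fin(2,1) sets le]) blast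
  have mu2: "mu2 = density mu2 (\<lambda>_. ennreal 1)"
    by (simp add: density_1)
  have Pf: "density L s1 \<in> fin_meas_prod A B" "density L s2 \<in> fin_meas_prod A B"
    and marg: "marg0 A (density L s1) = density mu2 a" "marg0 A (density L s2) = density mu2 (\<lambda>_. ennreal 1)"
      "marg1 B (density L s1) = density m d1" "marg1 B (density L s2) = density m d2"
    using P unfolding couplings_def mu2[symmetric] a(4)[symmetric] by auto
  show ?thesis
  proof (rule plan_exchange_fin_meas_prod[OF mu(2) m Pf sum s s_nonneg a(1) _ d_meas a(2) _ d marg])
    fix s :: "'a \<times> 'b \<Rightarrow> real" and r :: "'a \<Rightarrow> real" and q :: "'b \<Rightarrow> real"
    assume sq: "s \<in> borel_measurable L" "q \<in> borel_measurable m"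
      and between: "\<And>z. min (s1 z) (s2 z) \<le> s z" "\<And>z. s z \<le> max (s1 z) (s2 z)"
      and new: "density L s \<in> fin_meas_prod A B" "density L (\<lambda>z. s1 z + s2 z - s z) \<in> fin_meas_prod A B"
        "marg0 A (density L s) = density mu2 r"
        "marg0 A (density L (\<lambda>z. s1 z + s2 z - s z)) = density mu2 (\<lambda>x. a x + 1 - r x)"
        "marg1 B (density L s) = density m q"
        "marg1 B (density L (\<lambda>z. s1 z + s2 z - s z)) = density m (\<lambda>y. d1 y + d2 y - q y)"
      and r: "\<And>x. a x \<le> 1 \<Longrightarrow> r x = a x"
      and q: "\<And>y. d2 y < d1 y \<Longrightarrow> q y = (d1 y + d2 y) / 2"
        "\<And>y. d1 y \<le> d2 y \<Longrightarrow> d1 y \<le> q y \<and> q y \<le> d2 y"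
    have ra: "r = a" using r a(3) by auto
    show thesis
    proof (rule that[OF sq between])
      show "density L s \<in> couplings A B mu1 (density m q)"
        using new by (simp add: couplings_def ra a(4))
      show "density L (\<lambda>z. s1 z + s2 z - s z) \<in> couplings A B mu2 (density m (\<lambda>y. d1 y + d2 y - q y))"
        using new mu2 by (simp add: couplings_def ra)
      show "partially_swapped d1 d2 q"
        using q by (auto simp: partially_swapped_def)
    qed
  qed auto
qed

text \<open>The cost is linear in the plan, and the new plans have the same sum as the old
  ones.\<close>

lemma plan_cost_exchange:
  fixes c :: "'a::metric_space \<times> 'b::metric_space \<Rightarrow> real" and s1 s2 s :: "'a \<times> 'b \<Rightarrow> real"
  assumes A: "compact A" and B: "compact B" and c: "continuous_on (A \<times> B) c"
    and P: "density L s1 \<in> fin_meas_prod A B" "density L s2 \<in> fin_meas_prod A B"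
    and s: "s1 \<in> borel_measurable L" "s2 \<in> borel_measurable L" "s \<in> borel_measurable L"
      "\<And>z. 0 \<le> s1 z" "\<And>z. 0 \<le> s2 z" "\<And>z. min (s1 z) (s2 z) \<le> s z" "\<And>z. s z \<le> max (s1 z) (s2 z)"
  shows "integral\<^sup>L (density L s) c + integral\<^sup>L (density L (\<lambda>z. s1 z + s2 z - s z)) c
    = integral\<^sup>L (density L s1) c + integral\<^sup>L (density L s2) c"
proof (rule integral_density_exchange)
  show int: "integrable (density L s1) c" "integrable (density L s2) c"
    using P by (auto intro: plan_cost_bound[OF A B c])
  show "c \<in> borel_measurable L"
    using borel_measurable_integrable[OF int(1)] by simp
qed (use s in auto)

lemma exchangeable_OT_cost:
  fixes c :: "'a::metric_space \<times> 'b::metric_space \<Rightarrow> real"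
  assumes A: "compact A" and B: "compact B" and c: "continuous_on (A \<times> B) c" and m: "m \<in> fin_meas B"
  shows "exchangeable A (OT_cost A B c) m"
  unfolding exchangeable_def
proof (intro ballI allI impI)
  fix mu1 mu2 :: "'a measure" and d1 d2 :: "'b \<Rightarrow> real" and e1 e2 :: real
  assume mu: "mu1 \<in> fin_meas A" "mu2 \<in> fin_meas A" and le: "meas_le mu1 mu2"
    and int: "integrable m d1" "integrable m d2" and d: "\<forall>y. 0 \<le> d1 y" "\<forall>y. 0 \<le> d2 y"
    and "OT_cost A B c mu1 (density m d1) < ereal e1" "OT_cost A B c mu2 (density m d2) < ereal e2"
  then obtain P1 P2 where P: "P1 \<in> couplings A B mu1 (density m d1)" "P2 \<in> couplings A B mu2 (density m d2)"
    and lt: "integral\<^sup>L P1 c < e1" "integral\<^sup>L P2 c < e2"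
    by (auto simp: OT_cost_def INF_less_iff)
  then have Pf: "P1 \<in> fin_meas_prod A B" "P2 \<in> fin_meas_prod A B"
    by (auto simp: couplings_def)
  obtain L and s1 s2 :: "_ \<Rightarrow> real" where s: "s1 \<in> borel_measurable L" "s2 \<in> borel_measurable L"
      "\<And>z. 0 \<le> s1 z" "\<And>z. 0 \<le> s2 z"
    and PL: "P1 = density L s1" "P2 = density L s2"
    and sum: "\<And>C. C \<in> sets L \<Longrightarrow> emeasure L C = emeasure P1 C + emeasure P2 C"
    by (rule obtain_common_density[OF Pf]) blast
  show "\<exists>d\<in>borel_measurable m. partially_swapped d1 d2 d \<and>
      OT_cost A B c mu1 (density m d) + OT_cost A B c mu2 (density m (\<lambda>y. d1 y + d2 y - d y)) \<le> ereal (e1 + e2)"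
  proof (rule coupling_exchange[OF mu le m borel_measurable_integrable[OF int(1)] borel_measurable_integrable[OF int(2)]
          d[rule_format] s P[unfolded PL] sum[unfolded PL]])
    fix s :: "'a \<times> 'b \<Rightarrow> real" and q :: "'b \<Rightarrow> real"
    assume s': "s \<in> borel_measurable L" "\<And>z. min (s1 z) (s2 z) \<le> s z" "\<And>z. s z \<le> max (s1 z) (s2 z)"
      and new: "density L s \<in> couplings A B mu1 (density m q)"
        "density L (\<lambda>z. s1 z + s2 z - s z) \<in> couplings A B mu2 (density m (\<lambda>y. d1 y + d2 y - q y))"
      and q: "q \<in> borel_measurable m" "partially_swapped d1 d2 q"
  have "OT_cost A B c mu1 (density m q) + OT_cost A B c mu2 (density m (\<lambda>y. d1 y + d2 y - q y))
      \<le> ereal (integral\<^sup>L (density L s) c) + ereal (integral\<^sup>L (density L (\<lambda>z. s1 z + s2 z - s z)) c)"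
    unfolding OT_cost_def by (intro add_mono INF_lower new)
  also have "\<dots> = ereal (integral\<^sup>L P1 c + integral\<^sup>L P2 c)"
    using plan_cost_exchange[OF A B c Pf[unfolded PL] s(1,2) s'(1) s(3,4) s'(2,3)] by (simp add: PL)
  also have "\<dots> \<le> ereal (e1 + e2)" using lt by simp
    finally show ?thesis using q by blast
  qed
qed

section \<open>The entropic cost\<close>

lemma mult_ln_minus_ge:
  fixes s :: real
  assumes "0 \<le> s"
  shows "- 1 \<le> s * ln s - s"
proof (cases "s = 0")
  case False
  then have "s * (- ln s) \<le> s * (1 / s - 1)"
    using ln_le_minus_one[of "1 / s"] assms by (intro mult_left_mono) (auto simp: ln_div)
  then show ?thesis using False by (simp add: algebra_simps)
qed simp

lemma ext_int_cong_AE: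
  assumes "AE x in M. g x = g' x"
  shows "ext_int M g = ext_int M g'"
proof -
  have "(\<integral>\<^sup>+x. ennreal (g x) \<partial>M) = (\<integral>\<^sup>+x. ennreal (g' x) \<partial>M)"
    "(\<integral>\<^sup>+x. ennreal (- g x) \<partial>M) = (\<integral>\<^sup>+x. ennreal (- g' x) \<partial>M)"
    using assms by (auto intro!: nn_integral_cong_AE)
  then show ?thesis by (simp add: ext_int_def)
qed

context finite_measure
begin

text \<open>The constant -1 is the minimum of s ln s - s, attained at s = 1. On a finite measure it
  keeps the negative part integrable, so \<open>ext_int\<close> never becomes a difference of
  infinities.\<close>

lemma nn_integral_neg_part_le:
  assumes "\<And>x. - 1 \<le> g x"
  shows "(\<integral>\<^sup>+x. ennreal (- g x) \<partial>M) \<le> ennreal (measure M (space M))"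
proof -
  have "(\<integral>\<^sup>+x. ennreal (- g x) \<partial>M) \<le> (\<integral>\<^sup>+x. 1 \<partial>M)"
  proof (intro nn_integral_mono)
    show "ennreal (- g x) \<le> 1" for x
      using assms[of x] by (subst ennreal_1[symmetric], intro ennreal_leI) linarith
  qed
  then show ?thesis by (simp add: emeasure_eq_measure)
qed

lemma ext_int_ge:
  assumes "\<And>x. - 1 \<le> g x"
  shows "ereal (- measure M (space M)) \<le> ext_int M g"
  using nn_integral_neg_part_le[of g, OF assms]
  by (cases "\<integral>\<^sup>+x. ennreal (- g x) \<partial>M"; cases "\<integral>\<^sup>+x. ennreal (g x) \<partial>M")
    (auto simp: ext_int_def top_unique)

lemma integrable_of_ext_int:
  assumes [measurable]: "g \<in> borel_measurable M" and "\<And>x. - 1 \<le> g x" "ext_int M g < \<infinity>"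
  shows "integrable M g"
proof -
  have neg: "(\<integral>\<^sup>+x. ennreal (- g x) \<partial>M) \<noteq> \<infinity>"
    using nn_integral_neg_part_le[of g, OF assms(2)] by (auto simp: top_unique)
  moreover have "(\<integral>\<^sup>+x. ennreal (g x) \<partial>M) \<noteq> \<infinity>"
    using assms(3) neg
    by (cases "\<integral>\<^sup>+x. ennreal (- g x) \<partial>M") (auto simp: ext_int_def)
  ultimately show ?thesis by (simp add: real_integrable_def)
qed

lemma ext_int_eq_integral:
  assumes "integrable M g"
  shows "ext_int M g = ereal (integral\<^sup>L M g)"
proof -
  have "(\<integral>\<^sup>+x. ennreal (g x) \<partial>M) \<noteq> \<infinity>" "(\<integral>\<^sup>+x. ennreal (- g x) \<partial>M) \<noteq> \<infinity>"
    using assms by (auto simp: real_integrable_def)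
  then show ?thesis
    using real_lebesgue_integral_def[OF assms]
    by (cases "\<integral>\<^sup>+x. ennreal (- g x) \<partial>M"; cases "\<integral>\<^sup>+x. ennreal (g x) \<partial>M") (auto simp: ext_int_def)
qed

lemma KL_density:
  fixes p :: "'a \<Rightarrow> real"
  assumes [measurable]: "p \<in> borel_measurable M" and "\<And>x. 0 \<le> p x"
  shows "KL (density M p) M = ext_int M (\<lambda>x. p x * ln (p x) - p x)"
proof -
  have "AE x in M. ennreal (p x) = RN_deriv M (density M p) x"
    by (intro RN_deriv_unique) auto
  then have "AE x in M. enn2real (RN_deriv M (density M p) x) = p x"
    by (rule eventually_mono) (metis assms(2) enn2real_ennreal)
  then have "ext_int M (\<lambda>x. let s = enn2real (RN_deriv M (density M p) x) in s * ln s - s)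
      = ext_int M (\<lambda>x. p x * ln (p x) - p x)"
    by (intro ext_int_cong_AE) (auto simp: Let_def elim!: eventually_mono)
  then show ?thesis
    by (simp add: KL_def absolutely_continuousI_density)
qed

lemma KL_exchange:
  fixes p1 p2 p :: "'a \<Rightarrow> real"
  assumes [measurable]: "p1 \<in> borel_measurable M" "p2 \<in> borel_measurable M" "p \<in> borel_measurable M"
    and nonneg: "\<And>x. 0 \<le> p1 x" "\<And>x. 0 \<le> p2 x"
    and between: "\<And>x. min (p1 x) (p2 x) \<le> p x" "\<And>x. p x \<le> max (p1 x) (p2 x)"
    and fin: "KL (density M p1) M < \<infinity>" "KL (density M p2) M < \<infinity>"
  obtains k1 k2 k k' where "KL (density M p1) M = ereal k1" "KL (density M p2) M = ereal k2"
    "KL (density M p) M = ereal k" "KL (density M (\<lambda>x. p1 x + p2 x - p x)) M = ereal k'"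
    "k + k' \<le> k1 + k2"
proof -
  define phi where "phi s = s * ln s - s" for s :: real
  have KL: "KL (density M p) M = ext_int M (\<lambda>x. phi (p x))"
    if "p \<in> borel_measurable M" "\<And>x. 0 \<le> p x" for p
    using KL_density[OF that] by (simp add: phi_def)
  have phi_ge: "- 1 \<le> phi s" if "0 \<le> s" for s
    using mult_ln_minus_ge[OF that] by (simp add: phi_def)
  have [measurable]: "phi \<in> borel_measurable borel"
    unfolding phi_def[abs_def] by measurable
  have p: "0 \<le> p x" "0 \<le> p1 x + p2 x - p x" for x
    using nonneg[of x] between[of x] by (auto simp: min_def max_def split: if_splits)
  have int: "integrable M (\<lambda>x. phi (p1 x))" "integrable M (\<lambda>x. phi (p2 x))"
    using fin nonneg by (auto intro!: integrable_of_ext_int phi_ge simp: KL)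
  have le: "phi (p x) + phi (p1 x + p2 x - p x) \<le> phi (p1 x) + phi (p2 x)" for x
    unfolding phi_def using nonneg between by (intro convex_on_sum_between[OF convex_mult_ln_minus]) auto
  have base: "integrable M (\<lambda>x. \<bar>phi (p1 x)\<bar> + \<bar>phi (p2 x)\<bar> + 1)"
    using int by auto
  \<comment> \<open>Each new term is at least -1, so the upper bound on their sum also bounds each
    one from above; this is the origin of the summand 1.\<close>
  have "\<bar>phi (p x)\<bar> \<le> \<bar>phi (p1 x)\<bar> + \<bar>phi (p2 x)\<bar> + 1"
    "\<bar>phi (p1 x + p2 x - p x)\<bar> \<le> \<bar>phi (p1 x)\<bar> + \<bar>phi (p2 x)\<bar> + 1" for x
    using le[of x] phi_ge[OF p(1)[of x]] phi_ge[OF p(2)[of x]] by linarith+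
  then have int': "integrable M (\<lambda>x. phi (p x))" "integrable M (\<lambda>x. phi (p1 x + p2 x - p x))"
    by (auto intro!: Bochner_Integration.integrable_bound[OF base] AE_I2)
  have "KL (density M p') M = ereal (\<integral>x. phi (p' x) \<partial>M)"
    if "p' \<in> borel_measurable M" "\<And>x. 0 \<le> p' x" "integrable M (\<lambda>x. phi (p' x))" for p'
    using KL[OF that(1,2)] ext_int_eq_integral[OF that(3)] by simp
  note KL_eq = this[OF _ nonneg(1) int(1)] this[OF _ nonneg(2) int(2)] this[OF _ p(1) int'(1)]
    this[OF _ p(2) int'(2)]
  have "(\<integral>x. phi (p x) \<partial>M) + (\<integral>x. phi (p1 x + p2 x - p x) \<partial>M)
      \<le> (\<integral>x. phi (p1 x) \<partial>M) + (\<integral>x. phi (p2 x) \<partial>M)"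
    using integral_mono[OF Bochner_Integration.integrable_add[OF int'] Bochner_Integration.integrable_add[OF int] le]
    by (simp add: int int')
  then show ?thesis
    by (rule that[rotated 4]) (rule KL_eq; measurable)+
qed

end

lemma exchangeable_EOT_cost:
  fixes c :: "'a::metric_space \<times> 'b::metric_space \<Rightarrow> real"
  assumes A: "compact A" and B: "compact B" and c: "continuous_on (A \<times> B) c" and m: "m \<in> fin_meas B"
    and eps: "0 < eps" and alpha: "alpha \<in> fin_meas A" and beta: "beta \<in> fin_meas B"
  shows "exchangeable A (EOT_cost A B c eps alpha beta) m"
  unfolding exchangeable_def
proof (intro ballI allI impI)
  let ?K = "alpha \<Otimes>\<^sub>M beta" and ?T = "EOT_cost A B c eps alpha beta"
  interpret K: finite_measure ?K
    by (intro finite_measure_pair_measure finite_measure_fin_meas[OF alpha] finite_measure_fin_meas[OF beta])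
  fix mu1 mu2 :: "'a measure" and d1 d2 :: "'b \<Rightarrow> real" and e1 e2 :: real
  assume mu: "mu1 \<in> fin_meas A" "mu2 \<in> fin_meas A" and le: "meas_le mu1 mu2"
    and int: "integrable m d1" "integrable m d2" and d: "\<forall>y. 0 \<le> d1 y" "\<forall>y. 0 \<le> d2 y"
    and "?T mu1 (density m d1) < ereal e1" "?T mu2 (density m d2) < ereal e2"
  then obtain P1 P2 where P: "P1 \<in> couplings A B mu1 (density m d1)" "P2 \<in> couplings A B mu2 (density m d2)"
    and lt: "ereal (integral\<^sup>L P1 c) + ereal eps * KL P1 ?K < e1" "ereal (integral\<^sup>L P2 c) + ereal eps * KL P2 ?K < e2"
    by (auto simp: EOT_cost_def INF_less_iff)
  then have Pf: "P1 \<in> fin_meas_prod A B" "P2 \<in> fin_meas_prod A B"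
    by (auto simp: couplings_def)
  have KL_fin: "KL P1 ?K < \<infinity>" "KL P2 ?K < \<infinity>"
    using lt eps by auto
  then have ac: "sets P1 = sets ?K" "absolutely_continuous ?K P1" "sets P2 = sets ?K" "absolutely_continuous ?K P2"
    by (auto simp: KL_def split: if_splits)
  obtain p1 :: "_ \<Rightarrow> real" where p1 [measurable]: "p1 \<in> borel_measurable ?K" "\<And>z. 0 \<le> p1 z" "P1 = density ?K p1"
    using K.obtain_real_density[OF finite_measure_fin_meas_prod[OF Pf(1)] ac(2,1)] by metis
  obtain p2 :: "_ \<Rightarrow> real" where p2 [measurable]: "p2 \<in> borel_measurable ?K" "\<And>z. 0 \<le> p2 z" "P2 = density ?K p2"
    using K.obtain_real_density[OF finite_measure_fin_meas_prod[OF Pf(2)] ac(4,3)] by metis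
  \<comment> \<open>The exchange needs the sum of both plans as its reference \<open>L\<close>, and
    this sum is \<open>density ?K w\<close>. Where \<open>w\<close> vanishes so do \<open>p1\<close>
    and \<open>p2\<close>, and division by zero returns 0. Multiplying by \<open>w\<close> leads
    back to densities over \<open>?K\<close>, to which \<open>KL\<close> refers.\<close>
  define w where "w z = p1 z + p2 z" for z
  have [measurable]: "w \<in> borel_measurable ?K" unfolding w_def[abs_def] by measurable
  have w_nonneg: "0 \<le> w z" for z using p1(2) p2(2) by (simp add: w_def)
  define L where "L = density ?K w"
  define s1 s2 where "s1 z = p1 z / w z" and "s2 z = p2 z / w z" for z
  have sets_L: "sets L = sets ?K" by (simp add: L_def)
  have s_meas: "s1 \<in> borel_measurable L" "s2 \<in> borel_measurable L"
    unfolding s1_def[abs_def] s2_def[abs_def] L_def by measurable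
  have s_nonneg: "0 \<le> s1 z" "0 \<le> s2 z" for z
    using p1(2) p2(2) w_nonneg by (simp_all add: s1_def s2_def)
  have ws: "w z * s1 z = p1 z" "w z * s2 z = p2 z" for z
    using p1(2)[of z] p2(2)[of z] by (auto simp: s1_def s2_def w_def add_nonneg_eq_0_iff)
  have dL: "density L s = density ?K (\<lambda>z. w z * s z)"
    if "s \<in> borel_measurable L" "\<And>z. 0 \<le> s z" for s :: "'a \<times> 'b \<Rightarrow> real"
    unfolding L_def using that w_nonneg
    by (subst density_density_eq) (auto simp: ennreal_mult L_def)
  have PL: "P1 = density L s1" "P2 = density L s2"
    using s_meas s_nonneg by (simp_all add: dL ws p1(3) p2(3))
  have sum: "emeasure L C = emeasure (density L s1) C + emeasure (density L s2) C" if "C \<in> sets L" for C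
    using that p1(2) p2(2) unfolding PL[symmetric]
    by (simp add: p1(3) p2(3) L_def emeasure_density w_def distrib_right nn_integral_add)
  show "\<exists>d\<in>borel_measurable m. partially_swapped d1 d2 d \<and>
      ?T mu1 (density m d) + ?T mu2 (density m (\<lambda>y. d1 y + d2 y - d y)) \<le> ereal (e1 + e2)"
  proof (rule coupling_exchange[OF mu le m borel_measurable_integrable[OF int(1)] borel_measurable_integrable[OF int(2)]
          d[rule_format] s_meas s_nonneg P[unfolded PL] sum])
    fix s :: "'a \<times> 'b \<Rightarrow> real" and q :: "'b \<Rightarrow> real"
    assume s: "s \<in> borel_measurable L" "\<And>z. min (s1 z) (s2 z) \<le> s z" "\<And>z. s z \<le> max (s1 z) (s2 z)"
      and new: "density L s \<in> couplings A B mu1 (density m q)"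
        "density L (\<lambda>z. s1 z + s2 z - s z) \<in> couplings A B mu2 (density m (\<lambda>y. d1 y + d2 y - q y))"
      and q: "q \<in> borel_measurable m" "partially_swapped d1 d2 q"
    let ?P = "density L s" and ?P' = "density L (\<lambda>z. s1 z + s2 z - s z)"
    have [measurable]: "s \<in> borel_measurable ?K" using s(1) by (simp add: L_def)
    have s_pos: "0 \<le> s z" "0 \<le> s1 z + s2 z - s z" for z
      using s_nonneg[of z] s(2,3)[of z] by (auto simp: min_def max_def split: if_splits)
    have ws_between: "min (p1 z) (p2 z) \<le> w z * s z" "w z * s z \<le> max (p1 z) (p2 z)" for z
      using mult_left_mono[OF s(2)[of z] w_nonneg[of z]] mult_left_mono[OF s(3)[of z] w_nonneg[of z]]
        w_nonneg[of z] by (simp_all add: min_mult_distrib_left max_mult_distrib_left ws)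
    have "w z * (s1 z + s2 z - s z) = p1 z + p2 z - w z * s z" for z
      by (simp add: right_diff_distrib distrib_left ws)
    then have dens: "?P = density ?K (\<lambda>z. w z * s z)" "?P' = density ?K (\<lambda>z. p1 z + p2 z - w z * s z)"
      using dL[OF s(1) s_pos(1)]
        dL[OF borel_measurable_diff[OF borel_measurable_add[OF s_meas] s(1)] s_pos(2)] by simp_all
    have ws_meas: "(\<lambda>z. w z * s z) \<in> borel_measurable ?K" by measurable
    obtain k1 k2 k k' where k: "KL P1 ?K = ereal k1" "KL P2 ?K = ereal k2"
      "KL ?P ?K = ereal k" "KL ?P' ?K = ereal k'" "k + k' \<le> k1 + k2"
      unfolding dens p1(3) p2(3)
      by (rule K.KL_exchange[OF p1(1) p2(1) ws_meas p1(2) p2(2) ws_between KL_fin[unfolded p1(3) p2(3)]]) blast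
    have "?T mu1 (density m q) + ?T mu2 (density m (\<lambda>y. d1 y + d2 y - q y))
        \<le> (ereal (integral\<^sup>L ?P c) + ereal eps * KL ?P ?K) + (ereal (integral\<^sup>L ?P' c) + ereal eps * KL ?P' ?K)"
      unfolding EOT_cost_def by (intro add_mono INF_lower new)
    also have "\<dots> = ereal (integral\<^sup>L P1 c + integral\<^sup>L P2 c + eps * (k + k'))"
      using plan_cost_exchange[OF A B c Pf[unfolded PL] s_meas s(1) s_nonneg s(2,3)]
      by (simp add: k PL algebra_simps)
    also have "\<dots> \<le> ereal (e1 + e2)"
    proof -
      have "eps * (k + k') \<le> eps * (k1 + k2)" using eps k(5) by (intro mult_left_mono) auto
      then show ?thesis using lt by (simp add: k algebra_simps)
    qed
    finally show ?thesis using q by blast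
  qed
qed

section \<open>The unbalanced cost\<close>

lemma Hent_exchange_source:
  fixes r1 r2 r a :: "'a \<Rightarrow> real"
  assumes "finite_measure mu" and h: "entropy_fun h"
    and r_meas: "r1 \<in> borel_measurable mu" "r2 \<in> borel_measurable mu" "r \<in> borel_measurable mu"
    and a: "a \<in> borel_measurable mu" "\<And>x. 0 \<le> a x" "\<And>x. a x \<le> 1"
    and nonneg: "\<And>x. 0 \<le> r1 x" "\<And>x. 0 \<le> r2 x"
    and dom: "AE x in mu. perspective_dom (r1 x) (a x)"
    and r: "\<And>x. r1 x \<le> r2 x \<Longrightarrow> r x = r1 x" "\<And>x. r2 x \<le> r1 x \<Longrightarrow> r2 x \<le> r x \<and> r x \<le> r1 x"
  shows "Hent h (density mu a) (density mu r) + Hent h mu (density mu (\<lambda>x. r1 x + r2 x - r x))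
    \<le> Hent h (density mu a) (density mu r1) + Hent h mu (density mu r2)"
proof -
  interpret finite_measure mu by fact
  have convex: "convex_on {0..} h" using h by (simp add: entropy_fun_def)
  have r_ran: "0 \<le> r x" "r x \<le> r1 x + r2 x" for x
    using r[of x] nonneg[of x] by linarith+
  have "integrable mu a"
    using a by (intro integrable_const_bound[of _ 1]) auto
  moreover have dom2: "perspective_dom (r2 x) 1" for x
    using nonneg by (simp add: perspective_dom_def)
  \<comment> \<open>The base densities \<open>a\<close> and 1 stay fixed. Where r1 \<le> r2 nothing
    moves; where r2 < r1 the points (r2, 1) and (r1, a) are in antitone position because a \<le> 1,
    and the rectangle applies with the roles of the points swapped.\<close>
  moreover have "AE x in mu. exchange_improves h (r1 x) (a x) (r2 x) 1 (r x) (a x)"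
    using dom
  proof eventually_elim
    case (elim x)
    show ?case
    proof (cases "r1 x \<le> r2 x")
      case True
      then show ?thesis
        using exchange_improves_diagonal[OF convex elim dom2, of 0 x] r(1) by simp
    next
      case False
      then have "exchange_improves h (r2 x) 1 (r1 x) (a x) (r1 x + r2 x - r x) (a x + 1 - a x)"
        using r(2)[of x] a(3)[of x] by (intro exchange_improves_rectangle convex elim dom2) auto
      then show ?thesis by (subst (asm) exchange_improves_swap)
    qed
  qed
  ultimately show ?thesis
    using Hent_exchange[OF h r_meas, of a "\<lambda>_. 1" a] nonneg r_ran a dom
    by (simp add: density_1)
qed

text \<open>In the unbalanced problem the target density \<open>d\<close> is not tied to the plan's
  marginal \<open>q\<close> and has to be chosen. The gain for \<open>E\<close> dictates the
  midpoint where d2 < d1; elsewhere \<open>d\<close> moves by the same fraction as \<open>q\<close>,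
  which keeps the pair on the segment between the old pairs.\<close>

lemma Hent_exchange_target:
  fixes q1 q2 q d1 d2 d :: "'a \<Rightarrow> real"
  assumes "finite_measure m" and h: "entropy_fun h"
    and q_meas: "q1 \<in> borel_measurable m" "q2 \<in> borel_measurable m" "q \<in> borel_measurable m"
    and int: "integrable m d1" "integrable m d2" and d_meas: "d \<in> borel_measurable m"
    and nonneg: "\<And>y. 0 \<le> q1 y" "\<And>y. 0 \<le> q2 y" "\<And>y. 0 \<le> d1 y" "\<And>y. 0 \<le> d2 y"
    and dom: "AE y in m. perspective_dom (q1 y) (d1 y)" "AE y in m. perspective_dom (q2 y) (d2 y)"
    and q: "\<And>y. q2 y < q1 y \<Longrightarrow> q y = (q1 y + q2 y) / 2" "\<And>y. q1 y \<le> q2 y \<Longrightarrow> q1 y \<le> q y \<and> q y \<le> q2 y"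
    and d: "\<And>y. d y = (if d2 y < d1 y then (d1 y + d2 y) / 2
      else d1 y + (q y - q1 y) / (q2 y - q1 y) * (d2 y - d1 y))"
  shows "partially_swapped d1 d2 d"
    and "Hent h (density m d) (density m q)
        + Hent h (density m (\<lambda>y. d1 y + d2 y - d y)) (density m (\<lambda>y. q1 y + q2 y - q y))
      \<le> Hent h (density m d1) (density m q1) + Hent h (density m d2) (density m q2)"
proof -
  interpret finite_measure m by fact
  have convex: "convex_on {0..} h" using h by (simp add: entropy_fun_def)
  \<comment> \<open>If \<open>q1 y = q2 y\<close>, division by zero gives t = 0, which fits since
    then q = q1; if \<open>q2 y < q1 y\<close>, then t = 1/2.\<close>
  define t where "t y = (q y - q1 y) / (q2 y - q1 y)" for y
  have t: "0 \<le> t y" "t y \<le> 1" "q y = q1 y + t y * (q2 y - q1 y)" for y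
    using q[of y] by (cases "q1 y" "q2 y" rule: linorder_cases; simp add: t_def field_simps)+
  have d_eq: "d y = (if d2 y < d1 y then (d1 y + d2 y) / 2 else d1 y + t y * (d2 y - d1 y))" for y
    by (simp add: d t_def)
  have t_le: "0 \<le> t y * u" "t y * u \<le> u" if "0 \<le> u" for y u
    using that t(1,2)[of y] by (auto intro: mult_left_le_one_le)
  have "d1 y \<le> d y \<and> d y \<le> d2 y" if "d1 y \<le> d2 y" for y
    using t_le[of "d2 y - d1 y" y] that by (simp add: d_eq)
  then show swapped: "partially_swapped d1 d2 d"
    by (auto simp: partially_swapped_def d_eq)
  have q_ran: "0 \<le> q y" "q y \<le> q1 y + q2 y" for y
    using q[of y] nonneg(1,2)[of y] by (cases "q2 y < q1 y"; simp)+
  have d_ran: "0 \<le> d y" "d y \<le> d1 y + d2 y" for y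
    using swapped[unfolded partially_swapped_def, rule_format, of y] nonneg(3,4)[of y]
    by (simp_all split: if_splits)
  have "integrable m d"
    using d_ran d_meas
    by (intro Bochner_Integration.integrable_bound[OF Bochner_Integration.integrable_add[OF int]])
      (auto intro!: AE_I2 simp: order_trans[OF d_ran(2) abs_ge_self])
  moreover have "AE y in m. exchange_improves h (q1 y) (d1 y) (q2 y) (d2 y) (q y) (d y)"
    using dom
  proof eventually_elim
    case (elim y)
    \<comment> \<open>In the first case \<open>d\<close> is the midpoint while \<open>q\<close>
      stops anywhere between its ends, so the pair leaves the segment and only the rectangle covers
      it. In the other two cases both coordinates move by a common fraction.\<close>
    consider "d2 y < d1 y" "q1 y \<le> q2 y" | "d2 y < d1 y" "q2 y < q1 y" | "d1 y \<le> d2 y" by linarith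
    then show ?case
    proof cases
      case 1
      then show ?thesis
        using q(2)[of y] by (intro exchange_improves_rectangle convex elim) (auto simp: d_eq)
    next
      case 2
      then have "q y = q1 y + 1 / 2 * (q2 y - q1 y)" "d y = d1 y + 1 / 2 * (d2 y - d1 y)"
        using q(1)[of y] by (simp_all add: d_eq field_simps)
      then show ?thesis
        using exchange_improves_diagonal[OF convex elim, of "1 / 2"] by simp
    next
      case 3
      then have "d y = d1 y + t y * (d2 y - d1 y)" by (simp add: d_eq)
      then show ?thesis
        using exchange_improves_diagonal[OF convex elim t(1,2)[of y]] t(3)[of y] by simp
    qed
  qed
  ultimately show "Hent h (density m d) (density m q)
        + Hent h (density m (\<lambda>y. d1 y + d2 y - d y)) (density m (\<lambda>y. q1 y + q2 y - q y))
      \<le> Hent h (density m d1) (density m q1) + Hent h (density m d2) (density m q2)"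
    by (intro Hent_exchange h q_meas int nonneg q_ran d_ran dom)
qed

lemma obtain_density_of_Hent:
  fixes a :: "'a \<Rightarrow> real"
  assumes M: "finite_measure M" and a: "a \<in> borel_measurable M" "\<And>x. 0 \<le> a x"
    and rho: "finite_measure rho" and fin: "Hent h (density M a) rho < \<infinity>"
  obtains r :: "'a \<Rightarrow> real" where "r \<in> borel_measurable M" "\<And>x. 0 \<le> r x" "integrable M r" "rho = density M r"
    "AE x in M. perspective_dom (r x) (a x)"
proof -
  interpret finite_measure M by fact
  have *: "sets rho = sets M" "absolutely_continuous (density M a) rho"
    using Hent_finite_imp_absolutely_continuous[OF fin] by auto
  have "absolutely_continuous M (density M a)"
    using a by (intro absolutely_continuousI_density) auto
  then have "absolutely_continuous M rho"
    using *(2) by (auto simp: absolutely_continuous_def)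
  then obtain r :: "'a \<Rightarrow> real" where r: "r \<in> borel_measurable M" "\<And>x. 0 \<le> r x" "integrable M r" "rho = density M r"
    using obtain_real_density[OF rho _ *(1)] by metis
  moreover have "AE x in M. perspective_dom (r x) (a x)"
    using *(2) a r by (simp add: absolutely_continuous_density_iff)
  ultimately show ?thesis by (rule that)
qed

lemma finite_measure_marg0: "P \<in> fin_meas_prod A B \<Longrightarrow> finite_measure (marg0 A P)"
  unfolding marg0_def
  by (intro finite_measure.finite_measure_distr finite_measure_fin_meas_prod)
    (auto simp: fin_meas_prod_def prod_borel_def cong: measurable_cong_sets)

lemma finite_measure_marg1: "P \<in> fin_meas_prod A B \<Longrightarrow> finite_measure (marg1 B P)"
  unfolding marg1_def
  by (intro finite_measure.finite_measure_distr finite_measure_fin_meas_prod)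
    (auto simp: fin_meas_prod_def prod_borel_def cong: measurable_cong_sets)

lemma exchangeable_UOT_cost:
  fixes c :: "'a::metric_space \<times> 'b::metric_space \<Rightarrow> real"
  assumes A: "compact A" and B: "compact B" and c: "continuous_on (A \<times> B) c" and m: "m \<in> fin_meas B"
    and h0: "entropy_fun h0" and h1: "entropy_fun h1"
  shows "exchangeable A (UOT_cost A B c h0 h1) m"
  unfolding exchangeable_def
proof (intro ballI allI impI)
  let ?T = "UOT_cost A B c h0 h1"
  fix mu1 mu2 :: "'a measure" and d1 d2 :: "'b \<Rightarrow> real" and e1 e2 :: real
  assume mu: "mu1 \<in> fin_meas A" "mu2 \<in> fin_meas A" and le: "meas_le mu1 mu2"
    and int: "integrable m d1" "integrable m d2" and "\<forall>y. 0 \<le> d1 y" "\<forall>y. 0 \<le> d2 y"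
    and lt: "?T mu1 (density m d1) < ereal e1" "?T mu2 (density m d2) < ereal e2"
  then have d: "\<And>y. 0 \<le> d1 y" "\<And>y. 0 \<le> d2 y" by auto
  have d_meas: "d1 \<in> borel_measurable m" "d2 \<in> borel_measurable m"
    using int by auto
  let ?K = "\<lambda>mu nu P. Hent h0 mu (marg0 A P) + Hent h1 nu (marg1 B P) + ereal (integral\<^sup>L P c)"
  obtain P1 where P1: "P1 \<in> fin_meas_prod A B" "?K mu1 (density m d1) P1 < ereal e1"
    using lt(1) by (auto simp: UOT_cost_def INF_less_iff)
  obtain P2 where P2: "P2 \<in> fin_meas_prod A B" "?K mu2 (density m d2) P2 < ereal e2"
    using lt(2) by (auto simp: UOT_cost_def INF_less_iff)
  have H_fin: "Hent h0 mu1 (marg0 A P1) < \<infinity>" "Hent h1 (density m d1) (marg1 B P1) < \<infinity>"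
    "Hent h0 mu2 (marg0 A P2) < \<infinity>" "Hent h1 (density m d2) (marg1 B P2) < \<infinity>"
    using P1(2) P2(2) Hent_nonneg[of h0 mu1 "marg0 A P1"] Hent_nonneg[of h1 "density m d1" "marg1 B P1"]
      Hent_nonneg[of h0 mu2 "marg0 A P2"] Hent_nonneg[of h1 "density m d2" "marg1 B P2"]
    by auto
  have fin: "finite_measure mu1" "finite_measure mu2" "finite_measure m" and sets: "sets mu1 = sets mu2"
    using mu m by (auto simp: fin_meas_def intro: finite_measure_fin_meas)
  obtain a :: "'a \<Rightarrow> real" where a: "a \<in> borel_measurable mu2" "\<And>x. 0 \<le> a x" "\<And>x. a x \<le> 1" "mu1 = density mu2 a"
    by (rule meas_le_obtain_density[OF fin(2,1) sets le]) blast
  obtain r1 :: "'a \<Rightarrow> real" where r1: "r1 \<in> borel_measurable mu2" "\<And>x. 0 \<le> r1 x" "marg0 A P1 = density mu2 r1"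
    "AE x in mu2. perspective_dom (r1 x) (a x)"
    using obtain_density_of_Hent[OF fin(2) a(1,2) finite_measure_marg0[OF P1(1)] H_fin(1)[unfolded a(4)]] by metis
  have H3: "Hent h0 (density mu2 (\<lambda>_. ennreal 1)) (marg0 A P2) < \<infinity>"
    using H_fin(3) by (simp add: density_1)
  obtain r2 :: "'a \<Rightarrow> real" where r2: "r2 \<in> borel_measurable mu2" "\<And>x. 0 \<le> r2 x" "marg0 A P2 = density mu2 r2"
    using obtain_density_of_Hent[OF fin(2) borel_measurable_const zero_le_one finite_measure_marg0[OF P2(1)] H3]
    by metis
  obtain q1 :: "'b \<Rightarrow> real" where q1: "q1 \<in> borel_measurable m" "\<And>x. 0 \<le> q1 x" "marg1 B P1 = density m q1"
    "AE x in m. perspective_dom (q1 x) (d1 x)"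
    using obtain_density_of_Hent[OF fin(3) d_meas(1) d(1) finite_measure_marg1[OF P1(1)] H_fin(2)] by metis
  obtain q2 :: "'b \<Rightarrow> real" where q2: "q2 \<in> borel_measurable m" "\<And>x. 0 \<le> q2 x" "marg1 B P2 = density m q2"
    "AE x in m. perspective_dom (q2 x) (d2 x)"
    using obtain_density_of_Hent[OF fin(3) d_meas(2) d(2) finite_measure_marg1[OF P2(1)] H_fin(4)] by metis
  obtain L and s1 s2 :: "_ \<Rightarrow> real" where s: "s1 \<in> borel_measurable L" "s2 \<in> borel_measurable L"
      "\<And>z. 0 \<le> s1 z" "\<And>z. 0 \<le> s2 z"
    and PL: "P1 = density L s1" "P2 = density L s2"
    and sum: "\<And>C. C \<in> sets L \<Longrightarrow> emeasure L C = emeasure P1 C + emeasure P2 C"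
    by (rule obtain_common_density[OF P1(1) P2(1)]) blast
  show "\<exists>d\<in>borel_measurable m. partially_swapped d1 d2 d \<and>
      ?T mu1 (density m d) + ?T mu2 (density m (\<lambda>y. d1 y + d2 y - d y)) \<le> ereal (e1 + e2)"
  proof (rule plan_exchange_fin_meas_prod[OF mu(2) m P1(1)[unfolded PL] P2(1)[unfolded PL] sum[unfolded PL] s
        r1(1) r2(1) q1(1) q2(1) r1(2) r2(2) q1(2) q2(2)
        r1(3)[unfolded PL] r2(3)[unfolded PL] q1(3)[unfolded PL] q2(3)[unfolded PL]])
    fix s :: "'a \<times> 'b \<Rightarrow> real" and r :: "'a \<Rightarrow> real" and q :: "'b \<Rightarrow> real"
    assume meas: "s \<in> borel_measurable L" "r \<in> borel_measurable mu2" "q \<in> borel_measurable m"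
      and between: "\<And>z. min (s1 z) (s2 z) \<le> s z" "\<And>z. s z \<le> max (s1 z) (s2 z)"
      and new: "density L s \<in> fin_meas_prod A B" "density L (\<lambda>z. s1 z + s2 z - s z) \<in> fin_meas_prod A B"
      and marg: "marg0 A (density L s) = density mu2 r"
        "marg0 A (density L (\<lambda>z. s1 z + s2 z - s z)) = density mu2 (\<lambda>x. r1 x + r2 x - r x)"
        "marg1 B (density L s) = density m q"
        "marg1 B (density L (\<lambda>z. s1 z + s2 z - s z)) = density m (\<lambda>y. q1 y + q2 y - q y)"
      and r: "\<And>x. r1 x \<le> r2 x \<Longrightarrow> r x = r1 x" "\<And>x. r2 x \<le> r1 x \<Longrightarrow> r2 x \<le> r x \<and> r x \<le> r1 x"
      and q: "\<And>y. q2 y < q1 y \<Longrightarrow> q y = (q1 y + q2 y) / 2" "\<And>y. q1 y \<le> q2 y \<Longrightarrow> q1 y \<le> q y \<and> q y \<le> q2 y"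
    define d where "d y = (if d2 y < d1 y then (d1 y + d2 y) / 2
      else d1 y + (q y - q1 y) / (q2 y - q1 y) * (d2 y - d1 y))" for y
    have dm: "d \<in> borel_measurable m"
      using d_meas meas(3) q1(1) q2(1) unfolding d_def[abs_def] by measurable
    note target = Hent_exchange_target[OF fin(3) h1 q1(1) q2(1) meas(3) int dm q1(2) q2(2)
        \<open>\<And>y. 0 \<le> d1 y\<close> \<open>\<And>y. 0 \<le> d2 y\<close> q1(4) q2(4) q d_def]
    have source: "Hent h0 mu1 (density mu2 r) + Hent h0 mu2 (density mu2 (\<lambda>x. r1 x + r2 x - r x))
        \<le> Hent h0 mu1 (density mu2 r1) + Hent h0 mu2 (density mu2 r2)"
      unfolding a(4)
      by (rule Hent_exchange_source[OF fin(2) h0 r1(1) r2(1) meas(2) a(1-3) r1(2) r2(2) r1(4) r])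
    let ?P = "density L s" and ?P' = "density L (\<lambda>z. s1 z + s2 z - s z)"
    have cost: "integral\<^sup>L ?P c + integral\<^sup>L ?P' c = integral\<^sup>L P1 c + integral\<^sup>L P2 c"
      using plan_cost_exchange[OF A B c P1(1)[unfolded PL] P2(1)[unfolded PL]] \<open>s1 \<in> _\<close> \<open>s2 \<in> _\<close> meas(1)
        \<open>\<And>z. 0 \<le> s1 z\<close> \<open>\<And>z. 0 \<le> s2 z\<close> between by (simp add: PL)
    have "?T mu1 (density m d) + ?T mu2 (density m (\<lambda>y. d1 y + d2 y - d y))
        \<le> ?K mu1 (density m d) ?P + ?K mu2 (density m (\<lambda>y. d1 y + d2 y - d y)) ?P'"
      unfolding UOT_cost_def by (intro add_mono INF_lower new)
    also have "\<dots> = (Hent h0 mu1 (marg0 A ?P) + Hent h0 mu2 (marg0 A ?P'))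
        + (Hent h1 (density m d) (marg1 B ?P) + Hent h1 (density m (\<lambda>y. d1 y + d2 y - d y)) (marg1 B ?P'))
        + ereal (integral\<^sup>L ?P c + integral\<^sup>L ?P' c)"
      unfolding plus_ereal.simps(1)[symmetric] by (simp only: ac_simps)
    also have "\<dots> \<le> (Hent h0 mu1 (marg0 A P1) + Hent h0 mu2 (marg0 A P2))
        + (Hent h1 (density m d1) (marg1 B P1) + Hent h1 (density m d2) (marg1 B P2))
        + ereal (integral\<^sup>L P1 c + integral\<^sup>L P2 c)"
      unfolding cost marg r1(3) r2(3) q1(3) q2(3)
      by (intro add_mono source target(2) order_refl)
    also have "\<dots> = ?K mu1 (density m d1) P1 + ?K mu2 (density m d2) P2"
      unfolding plus_ereal.simps(1)[symmetric] by (simp only: ac_simps)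
    also have "\<dots> \<le> ereal (e1 + e2)"
      unfolding plus_ereal.simps(1)[symmetric] using P1(2) P2(2) by (intro add_mono) auto
    finally show ?thesis using target(1) dm by blast
  qed
qed

section \<open>Lower bounds and the comparison of minimizers\<close>

lemma measure_marg0:
  assumes P: "P \<in> fin_meas_prod A B"
  shows "measure (marg0 A P) A = measure P (A \<times> B)"
proof -
  have "fst \<in> measurable P (restrict_space borel A)"
    using P by (auto simp: fin_meas_prod_def prod_borel_def cong: measurable_cong_sets)
  moreover have "A \<in> sets (restrict_space borel A)"
    using sets.top[of "restrict_space borel A"] by (simp add: space_restrict_space)
  moreover have "fst -` A \<inter> space P = A \<times> B"
    using space_fin_meas_prod[OF P] by auto
  ultimately show ?thesis
    unfolding marg0_def by (simp add: measure_distr)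
qed

text \<open>Every coupling has the mass of \<open>mu\<close>, so the bound on \<open>c\<close> gives
  a lower bound uniform over all couplings.\<close>

lemma OT_cost_neq_MInf:
  fixes c :: "'a::metric_space \<times> 'b::metric_space \<Rightarrow> real"
  assumes A: "compact A" and B: "compact B" and c: "continuous_on (A \<times> B) c"
  shows "OT_cost A B c mu nu \<noteq> - \<infinity>"
proof -
  obtain C where C: "\<And>P. P \<in> fin_meas_prod A B \<Longrightarrow> integrable P c \<and> - (C * measure P (A \<times> B)) \<le> integral\<^sup>L P c"
    using plan_cost_bound[OF A B c] by metis
  have "ereal (- (C * measure mu A)) \<le> OT_cost A B c mu nu"
    unfolding OT_cost_def
  proof (rule INF_greatest)
    fix P assume "P \<in> couplings A B mu nu"
    then show "ereal (- (C * measure mu A)) \<le> ereal (integral\<^sup>L P c)"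
      using C[of P] measure_marg0[of P A B] by (auto simp: couplings_def)
  qed
  then show ?thesis by auto
qed

lemma EOT_cost_neq_MInf:
  fixes c :: "'a::metric_space \<times> 'b::metric_space \<Rightarrow> real"
  assumes A: "compact A" and B: "compact B" and c: "continuous_on (A \<times> B) c"
    and eps: "0 < eps" and alpha: "alpha \<in> fin_meas A" and beta: "beta \<in> fin_meas B"
  shows "EOT_cost A B c eps alpha beta mu nu \<noteq> - \<infinity>"
proof -
  let ?K = "alpha \<Otimes>\<^sub>M beta"
  interpret K: finite_measure ?K
    by (intro finite_measure_pair_measure finite_measure_fin_meas[OF alpha] finite_measure_fin_meas[OF beta])
  obtain C where C: "\<And>P. P \<in> fin_meas_prod A B \<Longrightarrow> integrable P c \<and> - (C * measure P (A \<times> B)) \<le> integral\<^sup>L P c"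
    using plan_cost_bound[OF A B c] by metis
  have KL: "ereal (- measure ?K (space ?K)) \<le> KL P ?K" for P
    unfolding KL_def Let_def by (auto intro!: K.ext_int_ge mult_ln_minus_ge)
  have "ereal (- (C * measure mu A) + eps * (- measure ?K (space ?K))) \<le> EOT_cost A B c eps alpha beta mu nu"
    unfolding EOT_cost_def
  proof (rule INF_greatest)
    fix P assume "P \<in> couplings A B mu nu"
    then have "ereal (- (C * measure mu A)) \<le> ereal (integral\<^sup>L P c)"
      using C[of P] measure_marg0[of P A B] by (auto simp: couplings_def)
    moreover have "ereal eps * ereal (- measure ?K (space ?K)) \<le> ereal eps * KL P ?K"
      using KL eps by (intro ereal_mult_left_mono) auto
    ultimately show "ereal (- (C * measure mu A) + eps * (- measure ?K (space ?K)))
        \<le> ereal (integral\<^sup>L P c) + ereal eps * KL P ?K"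
      unfolding plus_ereal.simps(1)[symmetric] times_ereal.simps(1)[symmetric] by (rule add_mono)
  qed
  then show ?thesis by auto
qed

text \<open>The mass of an unbalanced plan is not prescribed, and a negative \<open>c\<close>
  rewards large mass at a linear rate. Superlinear growth of \<open>h\<close> outweighs every such
  rate \<open>C\<close>.\<close>

lemma Hent_superlinear_bound:
  fixes mu :: "'a measure"
  assumes mu: "finite_measure mu" and h: "entropy_fun h" and C: "0 \<le> C"
  obtains D where "\<And>rho. finite_measure rho \<Longrightarrow> ereal (C * measure rho (space mu) - D) \<le> Hent h mu rho"
proof -
  interpret finite_measure mu by fact
  have "filterlim (\<lambda>s. h s / s) at_top at_top" and h_pos: "\<And>s. 0 \<le> s \<Longrightarrow> 0 \<le> h s"
    and convex: "convex_on {0..} h"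
    using h by (auto simp: entropy_fun_def)
  then have "eventually (\<lambda>s. C \<le> h s / s) at_top"
    by (auto simp: filterlim_at_top)
  then obtain s0 where s0: "\<And>s. s0 \<le> s \<Longrightarrow> C \<le> h s / s"
    by (auto simp: eventually_at_top_linorder)
  \<comment> \<open>Beyond \<open>S\<close> the growth quotient is at least \<open>C\<close>; below
    \<open>S\<close> the constant C S suffices. The maximum with 1 keeps the denominator
    positive.\<close>
  define S where "S = max s0 1"
  have lin: "C * s \<le> h s + C * S" if "0 \<le> s" for s
  proof (cases "S \<le> s")
    case True
    then have "C \<le> h s / s" "0 < s" using s0[of s] by (auto simp: S_def)
    then have "C * s \<le> h s" by (simp add: field_simps)
    moreover have "0 \<le> C * S" using C by (simp add: S_def)
    ultimately show ?thesis by simp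
  next
    case False
    then have "C * s \<le> C * S" using C by (intro mult_left_mono) auto
    then show ?thesis using h_pos[OF that] by simp
  qed
  show ?thesis
  proof (rule that)
    fix rho :: "'a measure" assume rho: "finite_measure rho"
    show "ereal (C * measure rho (space mu) - C * S * measure mu (space mu)) \<le> Hent h mu rho"
    proof (cases "Hent h mu rho < \<infinity>")
      case True
      then have "Hent h (density mu (\<lambda>_. ennreal 1)) rho < \<infinity>" by (simp add: density_1)
      then obtain r :: "'a \<Rightarrow> real" where r: "r \<in> borel_measurable mu" "\<And>x. 0 \<le> r x" "integrable mu r"
        "rho = density mu r"
        using obtain_density_of_Hent[OF mu borel_measurable_const zero_le_one rho] by metis
      have "Hent h (density mu (\<lambda>_. ennreal 1)) (density mu r)
          = enn2ereal (\<integral>\<^sup>+x. ennreal (perspective h (r x) 1) \<partial>mu)"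
        using r h by (intro Hent_density) (auto simp: perspective_dom_def)
      then have H: "Hent h mu rho = enn2ereal (\<integral>\<^sup>+x. ennreal (h (r x)) \<partial>mu)"
        by (simp add: r(4) density_1 perspective_def)
      have hr: "(\<lambda>x. h (r x)) \<in> borel_measurable mu"
        using measurable_convex_comp[OF convex r(1,2)] .
      then have int: "integrable mu (\<lambda>x. h (r x))"
        using True h_pos r(2) unfolding H
        by (intro integrableI_nonneg) (auto simp: less_ennreal.rep_eq)
      have "C * measure rho (space mu) = (\<integral>x. C * r x \<partial>mu)"
        using r by (simp add: measure_def emeasure_density nn_integral_eq_integral cong: nn_integral_cong_simp)
      also have "\<dots> \<le> (\<integral>x. h (r x) + C * S \<partial>mu)"
        using r int lin by (intro integral_mono) auto
      also have "\<dots> = (\<integral>x. h (r x) \<partial>mu) + C * S * measure mu (space mu)"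
        using int by (simp add: mult.commute)
      finally show ?thesis
        using int h_pos r(2) unfolding H by (simp add: nn_integral_eq_integral)
    qed auto
  qed
qed

lemma UOT_cost_neq_MInf:
  fixes c :: "'a::metric_space \<times> 'b::metric_space \<Rightarrow> real"
  assumes A: "compact A" and B: "compact B" and c: "continuous_on (A \<times> B) c"
    and mu: "mu \<in> fin_meas A" and h0: "entropy_fun h0"
  shows "UOT_cost A B c h0 h1 mu nu \<noteq> - \<infinity>"
proof -
  obtain C where C: "0 \<le> C"
    "\<And>P. P \<in> fin_meas_prod A B \<Longrightarrow> integrable P c \<and> - (C * measure P (A \<times> B)) \<le> integral\<^sup>L P c"
    using plan_cost_bound[OF A B c] by metis
  obtain D where D: "\<And>rho. finite_measure rho \<Longrightarrow> ereal (C * measure rho (space mu) - D) \<le> Hent h0 mu rho"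
    using Hent_superlinear_bound[OF finite_measure_fin_meas[OF mu] h0 C(1)] by metis
  have "ereal (- D) \<le> UOT_cost A B c h0 h1 mu nu"
    unfolding UOT_cost_def
  proof (rule INF_greatest)
    fix P assume P: "P \<in> fin_meas_prod A B"
    have "ereal (C * measure P (A \<times> B) - D) \<le> Hent h0 mu (marg0 A P)"
      using D[OF finite_measure_marg0[OF P]] by (simp add: space_fin_meas[OF mu] measure_marg0[OF P])
    then have "ereal (C * measure P (A \<times> B) - D) + 0 + ereal (- (C * measure P (A \<times> B)))
        \<le> Hent h0 mu (marg0 A P) + Hent h1 nu (marg1 B P) + ereal (integral\<^sup>L P c)"
      using C(2)[OF P] by (intro add_mono Hent_nonneg) auto
    then show "ereal (- D) \<le> Hent h0 mu (marg0 A P) + Hent h1 nu (marg1 B P) + ereal (integral\<^sup>L P c)"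
      by simp
  qed
  then show ?thesis by auto
qed

section \<open>Densities for the functional E, and comparison of minimizers\<close>

lemma Efun_density:
  fixes d :: "'b::metric_space \<Rightarrow> real"
  assumes B: "compact B" and m: "m \<in> fin_meas B" and V: "continuous_on B V" and f: "entropy_fun f"
    and d: "integrable m d" "\<And>y. 0 \<le> d y" and fd: "integrable m (\<lambda>y. f (d y))"
  shows "integrable m (\<lambda>y. d y * V y)"
    and "Efun f m V (density m d) = ereal ((\<integral>y. f (d y) \<partial>m) + (\<integral>y. d y * V y \<partial>m))"
proof -
  interpret finite_measure m by (rule finite_measure_fin_meas[OF m])
  have f_pos: "\<And>s. 0 \<le> s \<Longrightarrow> 0 \<le> f s" using f by (simp add: entropy_fun_def)
  have V_meas: "V \<in> borel_measurable m"
    using borel_measurable_continuous_on_restrict[OF V] m by (simp add: fin_meas_def cong: measurable_cong_sets)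
  have "bounded (V ` B)"
    by (intro compact_imp_bounded compact_continuous_image V B)
  then obtain C where C: "\<And>y. y \<in> B \<Longrightarrow> \<bar>V y\<bar> \<le> C"
    by (auto simp: bounded_iff)
  have "integrable m (\<lambda>y. C * d y)" using d by simp
  then show int: "integrable m (\<lambda>y. d y * V y)"
  proof (rule Bochner_Integration.integrable_bound)
    show "AE y in m. norm (d y * V y) \<le> norm (C * d y)"
    proof (rule AE_I2)
      fix y assume "y \<in> space m"
      then have "\<bar>V y\<bar> \<le> \<bar>C\<bar>" using C[of y] space_fin_meas[OF m] by simp
      then have "\<bar>d y\<bar> * \<bar>V y\<bar> \<le> \<bar>d y\<bar> * \<bar>C\<bar>" by (intro mult_left_mono) auto
      then show "norm (d y * V y) \<le> norm (C * d y)" by (simp add: abs_mult mult.commute)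
    qed
  qed (use V_meas d in auto)
  have "Hent f (density m (\<lambda>_. ennreal 1)) (density m d)
      = enn2ereal (\<integral>\<^sup>+y. ennreal (perspective f (d y) 1) \<partial>m)"
    using d f by (intro Hent_density) (auto simp: perspective_dom_def)
  then have "Hent f m (density m d) = ereal (\<integral>y. f (d y) \<partial>m)"
    using fd f_pos d(2) by (simp add: density_1 perspective_def nn_integral_eq_integral)
  moreover have "integral\<^sup>L (density m d) V = (\<integral>y. d y * V y \<partial>m)"
    using V_meas d by (subst integral_density) auto
  ultimately show "Efun f m V (density m d) = ereal ((\<integral>y. f (d y) \<partial>m) + (\<integral>y. d y * V y \<partial>m))"
    by (simp add: Efun_def)
qed

lemma obtain_density_of_Efun:
  fixes m :: "'b::metric_space measure"
  assumes m: "m \<in> fin_meas B" and nu: "nu \<in> fin_meas B" and f: "entropy_fun f" and fin: "Efun f m V nu < \<infinity>"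
  obtains d :: "'b \<Rightarrow> real" where "integrable m d" "\<And>y. 0 \<le> d y" "nu = density m d" "integrable m (\<lambda>y. f (d y))"
proof -
  interpret finite_measure m by (rule finite_measure_fin_meas[OF m])
  have f_pos: "\<And>s. 0 \<le> s \<Longrightarrow> 0 \<le> f s" and convex: "convex_on {0..} f"
    using f by (auto simp: entropy_fun_def)
  have H: "Hent f m nu < \<infinity>" using fin by (auto simp: Efun_def)
  then have "Hent f (density m (\<lambda>_. ennreal 1)) nu < \<infinity>" by (simp add: density_1)
  then obtain d :: "'b \<Rightarrow> real" where d: "d \<in> borel_measurable m" "\<And>y. 0 \<le> d y" "integrable m d" "nu = density m d"
    using obtain_density_of_Hent[OF finite_measure_fin_meas[OF m] borel_measurable_const zero_le_one
        finite_measure_fin_meas[OF nu]] by metis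
  have "Hent f (density m (\<lambda>_. ennreal 1)) (density m d)
      = enn2ereal (\<integral>\<^sup>+y. ennreal (perspective f (d y) 1) \<partial>m)"
    using d f by (intro Hent_density) (auto simp: perspective_dom_def)
  then have "enn2ereal (\<integral>\<^sup>+y. ennreal (f (d y)) \<partial>m) < \<infinity>"
    using H by (simp add: d(4) density_1 perspective_def)
  then have "integrable m (\<lambda>y. f (d y))"
    using measurable_convex_comp[OF convex d(1,2)] f_pos d(2)
    by (intro integrableI_nonneg) (auto simp: less_ennreal.rep_eq)
  then show ?thesis using d by (intro that)
qed

text \<open>If the minimal value were infinite, every measure would be a minimizer.\<close>
lemma unique_minimizer_finite:
  assumes m: "m \<in> fin_meas B" "emeasure m B \<noteq> 0"
    and min: "is_minimizer B T E mu nu" and uniq: "\<And>nu'. is_minimizer B T E mu nu' \<Longrightarrow> nu' = nu"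
  shows "T mu nu + E nu < \<infinity>"
proof (rule ccontr)
  assume "\<not> T mu nu + E nu < \<infinity>"
  then have "T mu nu' + E nu' = \<infinity>" if "nu' \<in> fin_meas B" for nu'
    using min that unfolding is_minimizer_def by (metis ereal_infty_less_eq(1) less_ereal.simps(4) not_less top_ereal_def top_unique)
  then have "is_minimizer B T E mu nu'" if "nu' \<in> fin_meas B" for nu'
    using that unfolding is_minimizer_def by (metis order_refl)
  moreover have "null_measure m \<in> fin_meas B" using m by (simp add: fin_meas_def)
  ultimately have "m = null_measure m" using m(1) uniq by metis
  then have "emeasure m B = 0" by (metis emeasure_null_measure)
  then show False using m(2) by simp
qed

text \<open>The exchanged densities \<open>d\<close> and \<open>d'\<close> compete with
  \<open>nu1\<close> and \<open>nu2\<close>. Adding both optimality inequalities, the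
  \<open>V\<close> terms cancel because d + d' = d1 + d2, the transport terms rise by at most the
  accuracy of the plans, and the \<open>f\<close> terms drop by at least the integral of
  \<open>G\<close>. So that integral vanishes.\<close>

lemma minimizers_mono_of_exchangeable:
  fixes mu1 mu2 :: "'a::metric_space measure" and m nu1 nu2 :: "'b::metric_space measure"
  assumes B: "compact B" and m: "m \<in> fin_meas B" "emeasure m B \<noteq> 0" and V: "continuous_on B V"
    and f: "entropy_fun f" "strict_convex_on {0..} f"
    and mu: "mu1 \<in> fin_meas A" "mu2 \<in> fin_meas A" "meas_le mu1 mu2"
    and T: "exchangeable A T m" "T mu1 nu1 \<noteq> - \<infinity>" "T mu2 nu2 \<noteq> - \<infinity>"
    and min1: "is_minimizer B T (Efun f m V) mu1 nu1"
    and uniq1: "\<And>nu. is_minimizer B T (Efun f m V) mu1 nu \<Longrightarrow> nu = nu1"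
    and min2: "is_minimizer B T (Efun f m V) mu2 nu2"
    and uniq2: "\<And>nu. is_minimizer B T (Efun f m V) mu2 nu \<Longrightarrow> nu = nu2"
  shows "meas_le nu1 nu2"
proof -
  interpret finite_measure m by (rule finite_measure_fin_meas[OF m(1)])
  have f_pos: "\<And>s. 0 \<le> s \<Longrightarrow> 0 \<le> f s" and convex: "convex_on {0..} f"
    using f by (auto simp: entropy_fun_def)
  have nu: "nu1 \<in> fin_meas B" "nu2 \<in> fin_meas B"
    using min1 min2 by (auto simp: is_minimizer_def)
  have fin: "T mu1 nu1 + Efun f m V nu1 < \<infinity>" "T mu2 nu2 + Efun f m V nu2 < \<infinity>"
    using unique_minimizer_finite[OF m min1 uniq1] unique_minimizer_finite[OF m min2 uniq2] by auto
  then have E_fin: "Efun f m V nu1 < \<infinity>" "Efun f m V nu2 < \<infinity>" by auto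
  obtain d1 :: "'b \<Rightarrow> real" where d1: "integrable m d1" "\<And>y. 0 \<le> d1 y" "nu1 = density m d1" "integrable m (\<lambda>y. f (d1 y))"
    by (rule obtain_density_of_Efun[OF m(1) nu(1) f(1) E_fin(1)]) blast
  obtain d2 :: "'b \<Rightarrow> real" where d2: "integrable m d2" "\<And>y. 0 \<le> d2 y" "nu2 = density m d2" "integrable m (\<lambda>y. f (d2 y))"
    by (rule obtain_density_of_Efun[OF m(1) nu(2) f(1) E_fin(2)]) blast
  have [measurable]: "d1 \<in> borel_measurable m" "d2 \<in> borel_measurable m" using d1 d2 by auto
  note E1 = Efun_density[OF B m(1) V f(1) d1(1,2,4)] and E2 = Efun_density[OF B m(1) V f(1) d2(1,2,4)]
  obtain T1 T2 where T12: "T mu1 nu1 = ereal T1" "T mu2 nu2 = ereal T2"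
    using fin T(2,3) by (cases "T mu1 nu1"; cases "T mu2 nu2") auto
  \<comment> \<open>The midpoint convexity gap of \<open>f\<close>, positive exactly where d2 < d1.
    It depends on the minimizers alone and is fixed before any plan is chosen.\<close>
  define G where "G y = (if d2 y < d1 y then f (d1 y) + f (d2 y) - 2 * f ((d1 y + d2 y) / 2) else 0)" for y
  have G_pos: "0 < G y" if "d2 y < d1 y" for y
  proof -
    have "f ((1 - 1/2) * d1 y + 1/2 * d2 y) < (1 - 1/2) * f (d1 y) + 1/2 * f (d2 y)"
      using f(2)[unfolded strict_convex_on_def, rule_format, of "d1 y" "d2 y" "1/2"] d1(2)[of y] d2(2)[of y] that by simp
    then have "f ((d1 y + d2 y) / 2) < f (d1 y) / 2 + f (d2 y) / 2" by (simp add: add_divide_distrib)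
    then show ?thesis using that by (simp add: G_def)
  qed
  then have G_nonneg: "0 \<le> G y" for y
    by (cases "d2 y < d1 y") (auto simp: G_def intro: less_imp_le)
  have mid_meas: "(\<lambda>y. f ((d1 y + d2 y) / 2)) \<in> borel_measurable m"
    using d1(2) d2(2) by (intro measurable_convex_comp[OF convex]) auto
  then have [measurable]: "G \<in> borel_measurable m"
    using borel_measurable_integrable[OF d1(4)] borel_measurable_integrable[OF d2(4)]
    unfolding G_def[abs_def] by measurable
  have G_le: "G y \<le> f (d1 y) + f (d2 y)" for y
    using f_pos[OF d1(2)[of y]] f_pos[OF d2(2)[of y]] f_pos[of "(d1 y + d2 y) / 2"] d1(2)[of y] d2(2)[of y]
    by (auto simp: G_def)
  have G_int: "integrable m G"
    using G_nonneg G_le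
    by (intro Bochner_Integration.integrable_bound[OF Bochner_Integration.integrable_add[OF d1(4) d2(4)]])
      (auto intro!: AE_I2 simp: order_trans[OF G_le abs_ge_self])
  have "integral\<^sup>L m G = 0"
  proof (rule ccontr)
    assume "integral\<^sup>L m G \<noteq> 0"
    then have G0: "0 < integral\<^sup>L m G"
      using G_nonneg by (simp add: less_le)
    \<comment> \<open>Two plans with error \<open>e\<close> each lose at most 2 e against a gain of
      4 e; any fraction of the integral below one half would do.\<close>
    define e where "e = integral\<^sup>L m G / 4"
    have "T mu1 (density m d1) < ereal (T1 + e)" "T mu2 (density m d2) < ereal (T2 + e)"
      using T12 G0 by (simp_all add: d1(3) d2(3) e_def)
    then obtain d where d_meas: "d \<in> borel_measurable m" and d: "partially_swapped d1 d2 d"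
      and T_le: "T mu1 (density m d) + T mu2 (density m (\<lambda>y. d1 y + d2 y - d y)) \<le> ereal ((T1 + e) + (T2 + e))"
      using T(1)[unfolded exchangeable_def, rule_format, OF mu d1(1) d2(1)] d1(2) d2(2) by metis
    define d' where "d' y = d1 y + d2 y - d y" for y
    have d_ran: "0 \<le> d y" "0 \<le> d' y" "d y \<le> d1 y + d2 y" "d' y \<le> d1 y + d2 y" for y
      using d[unfolded partially_swapped_def, rule_format, of y] d1(2)[of y] d2(2)[of y]
      by (auto simp: d'_def split: if_splits)
    have d'_meas: "d' \<in> borel_measurable m" using d_meas unfolding d'_def[abs_def] by measurable
    have int_d: "integrable m u" if "u \<in> borel_measurable m" "\<And>y. 0 \<le> u y" "\<And>y. u y \<le> d1 y + d2 y" for u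
      using that
      by (intro Bochner_Integration.integrable_bound[OF Bochner_Integration.integrable_add[OF d1(1) d2(1)]])
        (auto intro!: AE_I2 simp: order_trans[OF that(3) abs_ge_self])
    have f_le: "f (d y) + f (d' y) \<le> f (d1 y) + f (d2 y) - G y" for y
    proof (cases "d2 y < d1 y")
      case True
      then have mid: "d y = (d1 y + d2 y) / 2" "d' y = (d1 y + d2 y) / 2"
        using d[unfolded partially_swapped_def, rule_format, of y] by (simp_all add: d'_def field_simps)
      show ?thesis unfolding mid G_def using True by simp
    next
      case False
      then show ?thesis
        using convex_on_sum_between[OF convex, of "d1 y" "d2 y" "d y"] d1(2)[of y] d2(2)[of y]
          d[unfolded partially_swapped_def, rule_format, of y] by (simp add: G_def d'_def)
    qed
    have int_f: "integrable m (\<lambda>y. f (u y))" if "u \<in> borel_measurable m" "\<And>y. 0 \<le> u y"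
      "\<And>y. f (u y) \<le> f (d1 y) + f (d2 y)" for u
      using that measurable_convex_comp[OF convex that(1,2)] f_pos
      by (intro Bochner_Integration.integrable_bound[OF Bochner_Integration.integrable_add[OF d1(4) d2(4)]])
        (auto intro!: AE_I2 simp: order_trans[OF that(3) abs_ge_self])
    have "f (d y) \<le> f (d1 y) + f (d2 y)" "f (d' y) \<le> f (d1 y) + f (d2 y)" for y
      using f_le[of y] f_pos[OF d_ran(1)[of y]] f_pos[OF d_ran(2)[of y]] G_nonneg[of y] by linarith+
    then have fd: "integrable m (\<lambda>y. f (d y))" "integrable m (\<lambda>y. f (d' y))"
      using d_meas d'_meas d_ran by (auto intro!: int_f)
    have id: "integrable m d" "integrable m d'"
      using d_meas d'_meas d_ran by (auto intro!: int_d)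
    note E = Efun_density[OF B m(1) V f(1) id(1) d_ran(1) fd(1)]
      and E' = Efun_density[OF B m(1) V f(1) id(2) d_ran(2) fd(2)]
    have "sets m = sets (restrict_space borel B)" using m(1) by (simp add: fin_meas_def)
    then have "density m d \<in> fin_meas B" "density m d' \<in> fin_meas B"
      using id d_ran by (auto intro!: fin_measI finite_measure_density_real)
    then have "T mu1 nu1 + Efun f m V nu1 \<le> T mu1 (density m d) + Efun f m V (density m d)"
      "T mu2 nu2 + Efun f m V nu2 \<le> T mu2 (density m d') + Efun f m V (density m d')"
      using min1 min2 by (auto simp: is_minimizer_def)
    \<comment> \<open>Exchangeability bounds only the sum of the two transport costs, so the terms
      are regrouped before it is applied.\<close>
    from add_mono[OF this]
    have "(T mu1 nu1 + T mu2 nu2) + (Efun f m V nu1 + Efun f m V nu2)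
        \<le> (T mu1 (density m d) + T mu2 (density m d')) + (Efun f m V (density m d) + Efun f m V (density m d'))"
      by (simp only: ac_simps)
    also have "\<dots> \<le> ereal ((T1 + e) + (T2 + e)) + (Efun f m V (density m d) + Efun f m V (density m d'))"
      using T_le by (intro add_mono) (simp_all add: d'_def[abs_def])
    finally have "(\<integral>y. f (d1 y) \<partial>m) + (\<integral>y. d1 y * V y \<partial>m) + ((\<integral>y. f (d2 y) \<partial>m) + (\<integral>y. d2 y * V y \<partial>m))
        \<le> 2 * e + ((\<integral>y. f (d y) \<partial>m) + (\<integral>y. d y * V y \<partial>m) + ((\<integral>y. f (d' y) \<partial>m) + (\<integral>y. d' y * V y \<partial>m)))"
      unfolding E(2) E'(2) T12 unfolding d1(3) d2(3) E1(2) E2(2) by simp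
    moreover have "(\<integral>y. d1 y * V y \<partial>m) + (\<integral>y. d2 y * V y \<partial>m) = (\<integral>y. d y * V y \<partial>m) + (\<integral>y. d' y * V y \<partial>m)"
    proof -
      have "d1 y * V y + d2 y * V y = d y * V y + d' y * V y" for y
        by (simp add: d'_def algebra_simps)
      then show ?thesis
        unfolding Bochner_Integration.integral_add[OF E1(1) E2(1), symmetric]
          Bochner_Integration.integral_add[OF E(1) E'(1), symmetric] by (rule Bochner_Integration.integral_cong[OF refl])
    qed
    moreover have "(\<integral>y. f (d y) \<partial>m) + (\<integral>y. f (d' y) \<partial>m)
        \<le> (\<integral>y. f (d1 y) \<partial>m) + (\<integral>y. f (d2 y) \<partial>m) - integral\<^sup>L m G"
      using integral_mono[OF Bochner_Integration.integrable_add[OF fd]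
          Bochner_Integration.integrable_diff[OF Bochner_Integration.integrable_add[OF d1(4) d2(4)] G_int] f_le]
      by (simp add: fd d1(4) d2(4) G_int)
    ultimately have "4 * e \<le> 2 * e" by (simp add: e_def)
    then show False using G0 by (simp add: e_def)
  qed
  then have "AE y in m. G y = 0"
    using integral_nonneg_eq_0_iff_AE[OF G_int] G_nonneg by auto
  then have le: "AE y in m. d1 y \<le> d2 y"
    by (rule eventually_mono) (use G_pos in \<open>force simp: not_le[symmetric]\<close>)
  show ?thesis
    unfolding meas_le_def d1(3) d2(3)
  proof
    fix C assume "C \<in> sets (density m (\<lambda>y. ennreal (d1 y)))"
    then show "emeasure (density m d1) C \<le> emeasure (density m d2) C"
      using le by (auto simp: emeasure_density indicator_def intro!: nn_integral_mono_AE ennreal_leI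
          elim!: eventually_mono)
  qed
qed

theorem theorem3p22:
  fixes Om :: "'a::metric_space set" and Os :: "'b::metric_space set"
    and c :: "'a \<times> 'b \<Rightarrow> real"
    and T :: "'a measure \<Rightarrow> 'b measure \<Rightarrow> ereal"
    and f :: "real \<Rightarrow> real" and m :: "'b measure" and V :: "'b \<Rightarrow> real"
    and mu1 mu2 :: "'a measure" and nu1 nu2 :: "'b measure"
  assumes "compact Om" and "compact Os"
    and "continuous_on (Om \<times> Os) c"
    and T_cases: "T = OT_cost Om Os c
      \<or> (\<exists>eps alpha beta. eps > 0 \<and> alpha \<in> fin_meas Om \<and> beta \<in> fin_meas Os
           \<and> emeasure alpha Om \<noteq> 0 \<and> emeasure beta Os \<noteq> 0
           \<and> T = EOT_cost Om Os c eps alpha beta)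
      \<or> (\<exists>h0 h1. entropy_fun h0 \<and> entropy_fun h1 \<and> T = UOT_cost Om Os c h0 h1)"
    and "entropy_fun f" and "strict_convex_on {0..} f"
    and "m \<in> fin_meas Os" and "emeasure m Os \<noteq> 0"
    and "continuous_on Os V"
    and "mu1 \<in> fin_meas Om" and "mu2 \<in> fin_meas Om"
    and min1: "is_minimizer Os T (Efun f m V) mu1 nu1"
    and uniq1: "\<And>nu. is_minimizer Os T (Efun f m V) mu1 nu \<Longrightarrow> nu = nu1"
    and min2: "is_minimizer Os T (Efun f m V) mu2 nu2"
    and uniq2: "\<And>nu. is_minimizer Os T (Efun f m V) mu2 nu \<Longrightarrow> nu = nu2"
    and "meas_le mu1 mu2"
  shows "meas_le nu1 nu2"
proof -
  note compact = assms(1-3)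
  have T: "exchangeable Om T m \<and> (\<forall>mu\<in>fin_meas Om. \<forall>nu. T mu nu \<noteq> - \<infinity>)"
    using T_cases
  proof (elim disjE exE conjE)
    assume "T = OT_cost Om Os c"
    then show ?thesis
      using exchangeable_OT_cost[OF compact assms(7)] OT_cost_neq_MInf[OF compact] by simp
  next
    fix eps alpha beta
    assume "eps > 0" "alpha \<in> fin_meas Om" "beta \<in> fin_meas Os" "T = EOT_cost Om Os c eps alpha beta"
    then show ?thesis
      using exchangeable_EOT_cost[OF compact assms(7)] EOT_cost_neq_MInf[OF compact] by simp
  next
    fix h0 h1
    assume "entropy_fun h0" "entropy_fun h1" "T = UOT_cost Om Os c h0 h1"
    then show ?thesis
      using exchangeable_UOT_cost[OF compact assms(7)] UOT_cost_neq_MInf[OF compact] by simp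
  qed
  show ?thesis
  proof (rule minimizers_mono_of_exchangeable[OF assms(2,7-9,5,6,10,11,16) _ _ _ min1 uniq1 min2 uniq2])
    show "exchangeable Om T m" "T mu1 nu1 \<noteq> - \<infinity>" "T mu2 nu2 \<noteq> - \<infinity>"
      using T assms(10,11) by auto
  qed
qed

end
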